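(* Let $\mu>0$, $\lambda\ge0$, and consider the Cauchy problem $$\partial_t\rho+\operatorname{div}(\rho u)=0,\qquad \partial_t(\rho u)+\operatorname{div}(\rho u\otimes u+p\,I_3)=-\frac{\mu}{(1+t)^\lambda}\rho u,$$ $$\rho(0,x)=\bar\rho+\tilde\rho_0(x),\qquad u(0,x)=\tilde u_0(x),\qquad x\in\mathbb R^3,$$ where $\tilde\rho_0\in C_0^\infty(\mathbb R^3)$ and $\tilde u_0\in C_0^\infty(\mathbb R^3;\mathbb R^3)$ are supported in $\{x:|x|\le M\}$ and $\rho(0,\cdot)>0$. Put $$H(t)=\int_{\mathbb R^3}x\cdot(\rho u)(t,x)\,dx,\qquad L(t)=\int_{\mathbb R^3}\bigl(\rho(t,x)-\bar\rho\bigr)\,dx,$$ $$\alpha(t)=(t+M)^2\Bigl(L(0)+\frac{4\pi^2\bar\rho}{3}(t+M)^3\Bigr),$$ $$\beta(t)=\begin{cases}e^{\frac{\mu}{1-\lambda}[(1+t)^{1-\lambda}-1]},&\lambda\ge0,\ \lambda\ne1,\\ (1+t)^\mu,&\lambda=1.\end{cases}$$ Suppose that $L(0)\ge0$ and $$H(0)\int_0^{T^*}\frac{d\tau}{\alpha(\tau)\beta(\tau)}>1$$ for some $T^*>0$. Then $T<T^*$ holds for any solution $(\rho,u)\in C^1([0,T]\times\mathbb R^3)$ of the Cauchy problem.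
   Context: $\rho$ is the density, $u=(u_1,u_2,u_3)$ the velocity, $I_3$ the $3\times3$ identity matrix, and $p=p(\rho)=A\rho^\gamma$ the pressure with constants $A>0$, $\gamma>1$; $\bar\rho>0$ is a constant. The background sound speed is normalized throughout: $c(\bar\rho)=1$, where $c(\rho)=\sqrt{p'(\rho)}$, i.e. $A\gamma\bar\rho^{\gamma-1}=1$. *)

theory Defs
  imports "HOL-Analysis.Analysis"
begin

section \<open>Regularity classes\<close>

text \<open>\<^term>\<open>S\<close> may be a closed slab: derivatives are taken within \<^term>\<open>S\<close>, hence are one-sided
  at its boundary, and the derivative is required to be continuous up to the boundary.\<close>

definition C1_on :: "('a::real_normed_vector \<Rightarrow> 'b::real_normed_vector) \<Rightarrow> 'a set \<Rightarrow> bool" where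
  "C1_on f S \<longleftrightarrow>
     (\<exists>f'. (\<forall>z\<in>S. (f has_derivative blinfun_apply (f' z)) (at z within S)) \<and> continuous_on S f')"

text \<open>\<^term>\<open>Ck\<close> is meant for finite-dimensional domains, where continuity of all directional
  derivatives is the same as continuity of the derivative.\<close>

primrec Ck :: "nat \<Rightarrow> ('a::euclidean_space \<Rightarrow> 'b::real_normed_vector) \<Rightarrow> bool" where
  "Ck 0 f \<longleftrightarrow> continuous_on UNIV f"
| "Ck (Suc k) f \<longleftrightarrow>
     (\<forall>x. f differentiable (at x)) \<and> (\<forall>v. Ck k (\<lambda>x. frechet_derivative f (at x) v))"

definition supp :: "('a::topological_space \<Rightarrow> 'b::zero) \<Rightarrow> 'a set" where
  "supp f = closure {x. f x \<noteq> 0}"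

definition test_function :: "('a::euclidean_space \<Rightarrow> 'b::real_normed_vector) \<Rightarrow> bool" where
  "test_function f \<longleftrightarrow> (\<forall>k. Ck k f) \<and> compact (supp f)"

section \<open>Differential operators\<close>

definition pd :: "3 \<Rightarrow> (real^3 \<Rightarrow> real) \<Rightarrow> real^3 \<Rightarrow> real" where
  "pd i f x = deriv (\<lambda>h. f (x + h *\<^sub>R axis i 1)) 0"

definition div_vec :: "(real^3 \<Rightarrow> real^3) \<Rightarrow> real^3 \<Rightarrow> real" where
  "div_vec v x = (\<Sum>i\<in>UNIV. pd i (\<lambda>y. v y $ i) x)"

definition div_mat :: "(real^3 \<Rightarrow> real^3^3) \<Rightarrow> real^3 \<Rightarrow> real^3" where
  "div_mat F x = (\<chi> i. \<Sum>j\<in>UNIV. pd j (\<lambda>y. F y $ i $ j) x)"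

text \<open>The time derivative on \<open>[0,T]\<close> is one-sided at the two endpoints.\<close>

definition dt :: "real \<Rightarrow> (real \<Rightarrow> real^3 \<Rightarrow> 'b::real_normed_vector) \<Rightarrow> real \<Rightarrow> real^3 \<Rightarrow> 'b" where
  "dt T f t x = vector_derivative (\<lambda>s. f s x) (at t within {0..T})"

definition outer :: "real^3 \<Rightarrow> real^3 \<Rightarrow> real^3^3" where
  "outer v w = (\<chi> i j. v $ i * w $ j)"

section \<open>The damped compressible Euler system\<close>

definition pressure :: "real \<Rightarrow> real \<Rightarrow> real \<Rightarrow> real" where
  "pressure A \<gamma> \<rho> = A * \<rho> powr \<gamma>"

definition sound_speed :: "real \<Rightarrow> real \<Rightarrow> real \<Rightarrow> real" where
  "sound_speed A \<gamma> \<rho> = sqrt (deriv (pressure A \<gamma>) \<rho>)"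

text \<open>Positivity of the density at later times is deliberately not part of this notion: only
  positivity of the initial density is assumed, and for \<open>C\<^sup>1\<close> solutions it is inherited by later
  times through the continuity equation.\<close>

definition damped_euler_solution ::
  "real \<Rightarrow> real \<Rightarrow> real \<Rightarrow> real \<Rightarrow> real \<Rightarrow> (real^3 \<Rightarrow> real) \<Rightarrow> (real^3 \<Rightarrow> real^3) \<Rightarrow>
   real \<Rightarrow> (real \<Rightarrow> real^3 \<Rightarrow> real) \<Rightarrow> (real \<Rightarrow> real^3 \<Rightarrow> real^3) \<Rightarrow> bool" where
  "damped_euler_solution A \<gamma> \<rho>bar \<mu> lam \<rho>0 u0 T \<rho> u \<longleftrightarrow>
     C1_on (\<lambda>(t, x). \<rho> t x) ({0..T} \<times> UNIV) \<and>
     C1_on (\<lambda>(t, x). u t x) ({0..T} \<times> UNIV) \<and>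
     (\<forall>t\<in>{0..T}. \<forall>x.
        dt T \<rho> t x + div_vec (\<lambda>y. \<rho> t y *\<^sub>R u t y) x = 0) \<and>
     (\<forall>t\<in>{0..T}. \<forall>x.
        dt T (\<lambda>s y. \<rho> s y *\<^sub>R u s y) t x
          + div_mat (\<lambda>y. \<rho> t y *\<^sub>R outer (u t y) (u t y) + pressure A \<gamma> (\<rho> t y) *\<^sub>R mat 1) x
        = - (\<mu> / (1 + t) powr lam) *\<^sub>R (\<rho> t x *\<^sub>R u t x)) \<and>
     (\<forall>x. \<rho> 0 x = \<rho>bar + \<rho>0 x) \<and>
     (\<forall>x. u 0 x = u0 x)"

section \<open>Functionals and comparison functions\<close>

definition H_fun :: "(real \<Rightarrow> real^3 \<Rightarrow> real) \<Rightarrow> (real \<Rightarrow> real^3 \<Rightarrow> real^3) \<Rightarrow> real \<Rightarrow> real" where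
  "H_fun \<rho> u t = (LINT x|lborel. x \<bullet> (\<rho> t x *\<^sub>R u t x))"

definition L_fun :: "real \<Rightarrow> (real \<Rightarrow> real^3 \<Rightarrow> real) \<Rightarrow> real \<Rightarrow> real" where
  "L_fun \<rho>bar \<rho> t = (LINT x|lborel. \<rho> t x - \<rho>bar)"

text \<open>The argument \<^term>\<open>L0\<close> stands for \<open>L(0)\<close>.\<close>

definition alpha_fun :: "real \<Rightarrow> real \<Rightarrow> real \<Rightarrow> real \<Rightarrow> real" where
  "alpha_fun \<rho>bar M L0 t = (t + M)^2 * (L0 + 4 * pi^2 * \<rho>bar / 3 * (t + M)^3)"

definition beta_fun :: "real \<Rightarrow> real \<Rightarrow> real \<Rightarrow> real" where
  "beta_fun \<mu> lam t =
     (if lam = 1 then (1 + t) powr \<mu>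
      else exp (\<mu> / (1 - lam) * ((1 + t) powr (1 - lam) - 1)))"

end

theory Submission
  imports Defs
begin

text \<open>The proof is a virial argument. Outside the ball \<open>|x| \<le> M + t\<close> the solution equals the background state
  (\<open>finite_propagation_speed\<close>), so all integrals are over bounded sets and integrations by parts leave no
  boundary terms. Mass conservation gives \<open>L(t) = L(0)\<close>, and the momentum equation gives
  \<open>H' = \<integral> \<rho>|u|\<^sup>2 + 3 \<integral> (p(\<rho>) - p(\<rho>bar)) - \<mu> (1 + t)\<^sup>-\<^sup>\<lambda> H\<close>. The pressure integral is at least \<open>L(0) \<ge> 0\<close> because the
  pressure is convex and has slope \<open>c\<^sup>2 = 1\<close> at \<open>\<rho>bar\<close>, and the kinetic integral is at least \<open>H\<^sup>2/\<alpha>\<close> by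
  Cauchy--Schwarz (\<open>H_riccati\<close>). Here \<open>\<alpha>(t)\<close> bounds the second moment \<open>\<integral> \<rho>|x|\<^sup>2\<close> over the ball of radius \<open>M + t\<close>.
  Since \<open>\<beta>\<close> is the integrating factor of the damping, \<open>G = \<beta> H\<close> satisfies \<open>G' \<ge> G\<^sup>2/(\<alpha> \<beta>)\<close>. A positive solution of
  this Riccati inequality cannot live up to a time \<open>T*\<close> with \<open>G(0) \<integral>\<^sub>0\<^sup>T\<^sup>* 1/(\<alpha> \<beta>) > 1\<close> (\<open>riccati_blowup\<close>).

  Two facts about \<open>C\<^sup>1\<close> solutions have to be supplied. Finite propagation speed is proved by an energy
  estimate in backward cones (\<open>constant_state_at_tip_of_cone\<close>). The energy is the physical one, kinetic plus
  relative internal energy; it satisfies an exact balance law in which damping has the good sign. Near the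
  background its flux is bounded by nearly the sound speed \<open>1\<close> times its density, and a continuation in time
  on the compact cone shows that the state never leaves the background, whatever the solution does far away.
  Secondly, the density has to stay nonnegative for the convexity and Cauchy--Schwarz steps; this follows from
  an estimate for the square of its negative part (\<open>density_nonneg\<close>). The time derivatives of all these
  integrals are computed by \<open>balance_law\<close>.\<close>

section \<open>Integrals of compactly supported functions\<close>

definition cube :: "real \<Rightarrow> (real^3) set" where
  "cube r = cbox (- r *\<^sub>R One) (r *\<^sub>R One)"

lemma norm_le_imp_in_cube: "norm x \<le> r \<Longrightarrow> x \<in> cube r"
proof -
  assume n: "norm x \<le> r"
  have "\<bar>x \<bullet> i\<bar> \<le> r" if "i \<in> Basis" for i
    using Basis_le_norm[OF that, of x] n by linarith
  then show ?thesis
    unfolding cube_def by (auto simp: mem_box abs_le_iff minus_le_iff)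
qed

lemma integrable_compact_support:
  fixes f :: "real^3 \<Rightarrow> real"
  assumes "continuous_on UNIV f" and z: "\<And>x. norm x > R \<Longrightarrow> f x = 0"
  shows "integrable lborel f"
proof -
  have "integrable lborel (\<lambda>x. indicator (cball 0 R) x *\<^sub>R f x)"
    by (rule borel_integrable_compact) (auto intro: continuous_on_subset[OF assms(1)])
  also have "(\<lambda>x. indicator (cball 0 R) x *\<^sub>R f x) = f"
    using z by (force simp: fun_eq_iff indicator_def)
  finally show ?thesis .
qed

text \<open>Differentiation under the integral sign is done for gauge integrals over a box; this translates
  the Lebesgue integrals of the statement into that setting and back.\<close>

lemma lebesgue_integral_eq_integral_cube:
  fixes f :: "real^3 \<Rightarrow> real"
  assumes "continuous_on UNIV f" and z: "\<And>x. norm x > R \<Longrightarrow> f x = 0" and "R \<le> r"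
  shows "(LINT x|lborel. f x) = integral (cube r) f"
proof -
  have "(LINT x|lborel. f x) = integral UNIV f"
    using integral_lborel[OF integrable_compact_support[OF assms(1,2)]] by simp
  also have "integral UNIV f = integral UNIV (\<lambda>x. if x \<in> cube r then f x else 0)"
    by (rule arg_cong[where f = "integral UNIV"]) (use z norm_le_imp_in_cube[of _ r] \<open>R \<le> r\<close> in \<open>force simp: fun_eq_iff\<close>)
  also have "\<dots> = integral (cube r) f"
    by (rule Henstock_Kurzweil_Integration.integral_restrict_UNIV)
  finally show ?thesis .
qed

lemma lebesgue_integral_translation:
  fixes f :: "real^3 \<Rightarrow> real"
  assumes "continuous_on UNIV f"
  shows "(LINT x|lborel. f (x + c)) = (LINT x|lborel. f x)"
proof -
  have "f \<in> borel_measurable borel"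
    by (rule borel_measurable_continuous_onI) (rule assms)
  then have "(LINT x|distr lborel borel ((+) c). f x) = (LINT x|lborel. f (c + x))"
    by (intro integral_distr) auto
  then show ?thesis by (simp add: lborel_distr_plus add.commute)
qed

text \<open>Special case of the divergence theorem, obtained without Fubini: the integral of the translate
  \<open>f (x + h a)\<close> does not depend on \<open>h\<close>, and its \<open>h\<close>-derivative at \<open>0\<close> is the integral of \<open>f'\<close>.\<close>

lemma lebesgue_integral_partial_derivative_eq_0:
  fixes f f' :: "real^3 \<Rightarrow> real"
  assumes f: "continuous_on UNIV f" and f': "continuous_on UNIV f'"
    and d: "\<And>x. ((\<lambda>h. f (x + h *\<^sub>R a)) has_real_derivative f' x) (at 0)"
    and a: "norm a = 1"
    and z: "\<And>x. norm x > R \<Longrightarrow> f x = 0" and z': "\<And>x. norm x > R \<Longrightarrow> f' x = 0"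
  shows "(LINT x|lborel. f' x) = 0"
proof -
  \<comment> \<open>The cube contains the supports of all translates with \<open>|h| \<le> 1\<close>.\<close>
  let ?G = "\<lambda>h. integral (cube (R + 1)) (\<lambda>x. f (x + h *\<^sub>R a))"
  have cont: "continuous_on X (\<lambda>x. f (x + h *\<^sub>R a))" for h X
    by (rule continuous_on_compose2[OF f]) (auto intro!: continuous_intros)
  have "(?G has_real_derivative integral (cube (R + 1)) (\<lambda>x. f' (x + 0 *\<^sub>R a))) (at 0 within {-1..1})"
    unfolding cube_def
  proof (rule leibniz_rule_field_derivative)
    fix h :: real and x :: "real^3"
    have "((\<lambda>k. f ((x + h *\<^sub>R a) + (k - h) *\<^sub>R a)) has_real_derivative f' (x + h *\<^sub>R a) * (1 - 0)) (at h)"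
      by (rule DERIV_chain'[where f = "\<lambda>k. k - h" and g = "\<lambda>k. f ((x + h *\<^sub>R a) + k *\<^sub>R a)"])
        (use d[of "x + h *\<^sub>R a"] in \<open>auto intro!: derivative_eq_intros\<close>)
    then show "((\<lambda>h. f (x + h *\<^sub>R a)) has_real_derivative f' (x + h *\<^sub>R a)) (at h within {-1..1})"
      by (auto simp: algebra_simps intro: has_field_derivative_at_within)
  next
    show "continuous_on ({-1..1} \<times> cbox (- (R + 1) *\<^sub>R One) ((R + 1) *\<^sub>R One)) (\<lambda>(h, x). f' (x + h *\<^sub>R a))"
      unfolding split_beta by (rule continuous_on_compose2[OF f']) (auto intro!: continuous_intros)
  qed (auto intro!: integrable_continuous cont)
  then have 1: "(?G has_real_derivative (LINT x|lborel. f' x)) (at 0 within {-1..1})"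
    using lebesgue_integral_eq_integral_cube[OF f' z', of R "R + 1"] by simp
  have G: "?G h = (LINT x|lborel. f x)" if "h \<in> {-1..1}" for h
  proof -
    have "f (x + h *\<^sub>R a) = 0" if x: "norm x > R + 1" for x
    proof -
      have "norm x \<le> norm (x + h *\<^sub>R a) + norm (h *\<^sub>R a)"
        using norm_triangle_ineq4[of "x + h *\<^sub>R a" "h *\<^sub>R a"] by simp
      moreover have "norm (h *\<^sub>R a) \<le> 1" using a \<open>h \<in> {-1..1}\<close> by auto
      ultimately show ?thesis using x by (intro z) simp
    qed
    then show ?thesis
      using lebesgue_integral_eq_integral_cube[OF cont[of UNIV h], of "R + 1" "R + 1"]
        lebesgue_integral_translation[OF f, of "h *\<^sub>R a"] by simp
  qed
  have "((\<lambda>h. LINT x|lborel. f x) has_real_derivative (LINT x|lborel. f' x)) (at 0 within {-1..1})"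
    by (rule has_field_derivative_transform_within[OF 1, of 1]) (auto simp: G[symmetric])
  moreover have "((\<lambda>h::real. LINT x|lborel. f x) has_real_derivative 0) (at 0 within {-1..1})"
    by simp
  moreover have "at (0::real) within {-1..1} \<noteq> bot"
    using at_within_Icc_at[of "-1" "0::real" 1] by simp
  ultimately show ?thesis
    using has_field_derivative_unique by blast
qed

lemma nonneg_continuous_integral_nonpos_imp_0:
  fixes f :: "real^3 \<Rightarrow> real"
  assumes f: "continuous_on UNIV f" and z: "\<And>x. norm x > R \<Longrightarrow> f x = 0"
    and nn: "\<And>x. f x \<ge> 0" and i: "(LINT x|lborel. f x) \<le> 0"
  shows "f x = 0"
proof -
  define S where "S = \<bar>R\<bar> + norm x + 1"
  have S: "R \<le> S" "norm x \<le> S" "S > 0" unfolding S_def using norm_ge_zero[of x] by linarith+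
  have "integral (cube S) f \<le> 0"
    using lebesgue_integral_eq_integral_cube[OF f z S(1)] i by simp
  moreover have "integral (cube S) f \<ge> 0"
    by (rule Henstock_Kurzweil_Integration.integral_nonneg)
      (auto simp: cube_def nn intro!: integrable_continuous continuous_on_subset[OF f])
  ultimately have "integral (cube S) f = 0" by simp
  moreover have "f integrable_on cube S"
    unfolding cube_def by (intro integrable_continuous continuous_on_subset[OF f]) auto
  ultimately have "(f has_integral 0) (cube S)"
    by (metis integrable_integral)
  moreover have "box (- S *\<^sub>R One) (S *\<^sub>R One :: real^3) \<noteq> {}"
    using S(3) by (simp add: box_ne_empty)
  ultimately show ?thesis
    using has_integral_0_cbox_imp_0[OF continuous_on_subset[OF f] _ _ _ , of "- S *\<^sub>R One" "S *\<^sub>R One" x]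
      nn norm_le_imp_in_cube[OF S(2)] unfolding cube_def by blast
qed

section \<open>Scalar fields with continuous first partial derivatives\<close>

text \<open>All fields are treated as real-valued functions of \<open>(t, x)\<close>, and their partial derivatives are
  carried along explicitly: \<open>ft\<close> is the time derivative (one-sided at both ends of \<open>[0, T]\<close>) and \<open>fx j\<close>
  the derivative in the \<open>j\<close>-th coordinate direction. Being closed under products and compositions, the
  notion lets the conservation laws below be checked by polynomial algebra in these derivatives.\<close>

definition has_C1_partials ::
  "real \<Rightarrow> (real \<Rightarrow> real^3 \<Rightarrow> real) \<Rightarrow> (real \<Rightarrow> real^3 \<Rightarrow> real) \<Rightarrow> (3 \<Rightarrow> real \<Rightarrow> real^3 \<Rightarrow> real) \<Rightarrow> bool" where
  "has_C1_partials T f ft fx \<longleftrightarrow>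
     continuous_on ({0..T} \<times> UNIV) (\<lambda>z. f (fst z) (snd z)) \<and>
     continuous_on ({0..T} \<times> UNIV) (\<lambda>z. ft (fst z) (snd z)) \<and>
     (\<forall>j. continuous_on ({0..T} \<times> UNIV) (\<lambda>z. fx j (fst z) (snd z))) \<and>
     (\<forall>t\<in>{0..T}. \<forall>x. ((\<lambda>s. f s x) has_real_derivative ft t x) (at t within {0..T}) \<and>
        (\<forall>j. ((\<lambda>h. f t (x + h *\<^sub>R axis j 1)) has_real_derivative fx j t x) (at 0)))"

lemma C1_continuous:
  assumes "has_C1_partials T f ft fx"
  shows "continuous_on ({0..T} \<times> UNIV) (\<lambda>z. f (fst z) (snd z))"
    and "continuous_on ({0..T} \<times> UNIV) (\<lambda>z. ft (fst z) (snd z))"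
    and "continuous_on ({0..T} \<times> UNIV) (\<lambda>z. fx j (fst z) (snd z))"
  using assms unfolding has_C1_partials_def by auto

lemma C1_time_derivative:
  assumes "has_C1_partials T f ft fx" "t \<in> {0..T}"
  shows "((\<lambda>s. f s x) has_real_derivative ft t x) (at t within {0..T})"
  using assms unfolding has_C1_partials_def by auto

lemma C1_space_derivative:
  assumes "has_C1_partials T f ft fx" "t \<in> {0..T}"
  shows "((\<lambda>h. f t (x + h *\<^sub>R axis j 1)) has_real_derivative fx j t x) (at 0)"
  using assms unfolding has_C1_partials_def by auto

lemma continuous_on_slice:
  assumes "continuous_on ({0..T} \<times> UNIV) (\<lambda>z. f (fst z) (snd z))" "t \<in> {0..T}"
  shows "continuous_on X (\<lambda>x. f t x)"
proof -
  have "continuous_on X (Pair t)" by (intro continuous_intros)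
  moreover have "Pair t ` X \<subseteq> {0..T} \<times> UNIV" using assms(2) by auto
  ultimately show ?thesis
    using continuous_on_compose2[OF assms(1), of X "Pair t"] by simp
qed

lemma C1_pd:
  assumes "has_C1_partials T f ft fx" "t \<in> {0..T}"
  shows "pd j (\<lambda>y. f t y) x = fx j t x"
  unfolding pd_def by (rule DERIV_imp_deriv[OF C1_space_derivative[OF assms]])

lemma C1_restrict:
  assumes "has_C1_partials T f ft fx" "T' \<le> T"
  shows "has_C1_partials T' f ft fx"
proof -
  have sub: "{0..T'} \<times> UNIV \<subseteq> {0..T} \<times> (UNIV :: (real^3) set)" "{0..T'} \<subseteq> {0..T}"
    using assms(2) by auto
  show ?thesis
    unfolding has_C1_partials_def
  proof (intro conjI allI ballI)
    fix t x j assume t: "t \<in> {0..T'}"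
    then have t': "t \<in> {0..T}" using assms(2) by simp
    show "((\<lambda>s. f s x) has_real_derivative ft t x) (at t within {0..T'})"
      by (rule DERIV_subset[OF C1_time_derivative[OF assms(1) t'] sub(2)])
    show "((\<lambda>h. f t (x + h *\<^sub>R axis j 1)) has_real_derivative fx j t x) (at 0)"
      by (rule C1_space_derivative[OF assms(1) t'])
  qed (rule continuous_on_subset[OF C1_continuous(1)[OF assms(1)] sub(1)]
        continuous_on_subset[OF C1_continuous(2)[OF assms(1)] sub(1)]
        continuous_on_subset[OF C1_continuous(3)[OF assms(1)] sub(1)])+
qed

text \<open>Product and chain rules produce derivatives in a shape dictated by the rule; this replaces them
  by the shape that is wanted.\<close>

lemma C1_rhs:
  assumes "has_C1_partials T f ft fx" "\<And>t x. ft t x = ft' t x" "\<And>j t x. fx j t x = fx' j t x"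
  shows "has_C1_partials T f ft' fx'"
proof -
  have "ft = ft'" "fx = fx'" using assms(2,3) by (auto simp: fun_eq_iff)
  then show ?thesis using assms(1) by simp
qed

lemma C1_const: "has_C1_partials T (\<lambda>t x. c) (\<lambda>t x. 0) (\<lambda>j t x. 0)"
  unfolding has_C1_partials_def by (auto intro!: continuous_intros)

lemma C1_time:
  assumes "\<And>t. t \<in> {0..T} \<Longrightarrow> (f has_real_derivative f' t) (at t within {0..T})" "continuous_on {0..T} f'"
  shows "has_C1_partials T (\<lambda>t x. f t) (\<lambda>t x. f' t) (\<lambda>j t x. 0)"
proof -
  have f: "continuous_on {0..T} f"
    using assms(1) DERIV_continuous continuous_on_eq_continuous_within by blast
  show ?thesis
    unfolding has_C1_partials_def using assms(1)
    by (auto intro!: continuous_on_compose2[OF f] continuous_on_compose2[OF assms(2)] continuous_intros)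
qed

lemma C1_coordinate:
  "has_C1_partials T (\<lambda>t x. x $ i) (\<lambda>t x. 0) (\<lambda>j t x. if i = j then 1 else 0)"
  unfolding has_C1_partials_def
  by (auto simp: axis_def intro!: continuous_intros derivative_eq_intros)

lemma C1_add:
  assumes "has_C1_partials T f ft fx" "has_C1_partials T g gt gx"
  shows "has_C1_partials T (\<lambda>t x. f t x + g t x) (\<lambda>t x. ft t x + gt t x) (\<lambda>j t x. fx j t x + gx j t x)"
  using assms unfolding has_C1_partials_def
  by (auto intro!: continuous_intros derivative_eq_intros)

lemma C1_diff:
  assumes "has_C1_partials T f ft fx" "has_C1_partials T g gt gx"
  shows "has_C1_partials T (\<lambda>t x. f t x - g t x) (\<lambda>t x. ft t x - gt t x) (\<lambda>j t x. fx j t x - gx j t x)"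
  using assms unfolding has_C1_partials_def
  by (auto intro!: continuous_intros derivative_eq_intros)

lemma C1_mult:
  assumes "has_C1_partials T f ft fx" "has_C1_partials T g gt gx"
  shows "has_C1_partials T (\<lambda>t x. f t x * g t x)
    (\<lambda>t x. ft t x * g t x + f t x * gt t x) (\<lambda>j t x. fx j t x * g t x + f t x * gx j t x)"
  unfolding has_C1_partials_def
proof (intro conjI allI ballI)
  fix t x j assume t: "t \<in> {0..T}"
  show "((\<lambda>s. f s x * g s x) has_real_derivative ft t x * g t x + f t x * gt t x) (at t within {0..T})"
    using DERIV_mult[OF C1_time_derivative[OF assms(1) t] C1_time_derivative[OF assms(2) t]]
    by (simp add: algebra_simps)
  show "((\<lambda>h. f t (x + h *\<^sub>R axis j 1) * g t (x + h *\<^sub>R axis j 1)) has_real_derivative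
      fx j t x * g t x + f t x * gx j t x) (at 0)"
    using DERIV_mult[OF C1_space_derivative[OF assms(1) t] C1_space_derivative[OF assms(2) t]]
    by (simp add: algebra_simps)
qed (intro continuous_intros C1_continuous[OF assms(1)] C1_continuous[OF assms(2)])+

lemma C1_cmult:
  assumes "has_C1_partials T f ft fx"
  shows "has_C1_partials T (\<lambda>t x. c * f t x) (\<lambda>t x. c * ft t x) (\<lambda>j t x. c * fx j t x)"
  using C1_mult[OF C1_const assms] by simp

lemma C1_sum:
  assumes "\<And>i. i \<in> I \<Longrightarrow> has_C1_partials T (f i) (ft i) (fx i)"
  shows "has_C1_partials T (\<lambda>t x. \<Sum>i\<in>I. f i t x) (\<lambda>t x. \<Sum>i\<in>I. ft i t x) (\<lambda>j t x. \<Sum>i\<in>I. fx i j t x)"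
  using assms by (induction I rule: infinite_finite_induct) (auto intro!: C1_const C1_add)

lemma C1_compose:
  assumes f: "has_C1_partials T f ft fx"
    and g: "\<And>s. (g has_real_derivative g' s) (at s)" and g': "continuous_on UNIV g'"
  shows "has_C1_partials T (\<lambda>t x. g (f t x)) (\<lambda>t x. g' (f t x) * ft t x) (\<lambda>j t x. g' (f t x) * fx j t x)"
  unfolding has_C1_partials_def
proof (intro conjI allI ballI)
  have cg: "continuous_on UNIV g"
    using g DERIV_continuous_on by blast
  show "continuous_on ({0..T} \<times> UNIV) (\<lambda>z. g (f (fst z) (snd z)))"
    by (rule continuous_on_compose2[OF cg C1_continuous(1)[OF f]]) simp
  have c': "continuous_on ({0..T} \<times> UNIV) (\<lambda>z. g' (f (fst z) (snd z)))"
    by (rule continuous_on_compose2[OF g' C1_continuous(1)[OF f]]) simp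
  show "continuous_on ({0..T} \<times> UNIV) (\<lambda>z. g' (f (fst z) (snd z)) * ft (fst z) (snd z))"
    by (intro continuous_intros c' C1_continuous[OF f])
  show "continuous_on ({0..T} \<times> UNIV) (\<lambda>z. g' (f (fst z) (snd z)) * fx j (fst z) (snd z))" for j
    by (intro continuous_intros c' C1_continuous[OF f])
next
  fix t x j assume t: "t \<in> {0..T}"
  show "((\<lambda>s. g (f s x)) has_real_derivative g' (f t x) * ft t x) (at t within {0..T})"
    using DERIV_chain2[OF g C1_time_derivative[OF f t]] .
  show "((\<lambda>h. g (f t (x + h *\<^sub>R axis j 1))) has_real_derivative g' (f t x) * fx j t x) (at 0)"
    using DERIV_chain2[where f=g and g = "\<lambda>h. f t (x + h *\<^sub>R axis j 1)" and x=0 and s=UNIV, OF g C1_space_derivative[OF f t]]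
    by simp
qed

section \<open>Balance laws with compact support\<close>

text \<open>The one integration argument behind every functional in the proof: the space derivatives
  \<open>\<partial>\<^sub>jF\<^sub>j\<close> integrate to zero, so adding the divergence of an arbitrary compactly supported flux does not
  change the derivative of the integral. The added term is what makes the integrand computable from
  the equations.\<close>

lemma balance_law:
  assumes T: "T > 0" and e: "has_C1_partials T e et ex"
    and F: "\<And>j. has_C1_partials T (F j) (Ft j) (Fx j)"
    and ze: "\<And>t x. t \<in> {0..T} \<Longrightarrow> norm x > R \<Longrightarrow> e t x = 0"
    and zF: "\<And>t x j. t \<in> {0..T} \<Longrightarrow> norm x > R \<Longrightarrow> F j t x = 0"
    and t: "t \<in> {0..T}"
  shows "((\<lambda>s. LINT x|lborel. e s x) has_real_derivative
           (LINT x|lborel. et t x + (\<Sum>j\<in>UNIV. Fx j j t x))) (at t within {0..T})"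
    and "integrable lborel (\<lambda>x. et t x + (\<Sum>j\<in>UNIV. Fx j j t x))"
proof -
  have zet: "et s x = 0" if s: "s \<in> {0..T}" and x: "norm x > R" for s x
  proof -
    have "((\<lambda>s. 0::real) has_real_derivative et s x) (at s within {0..T})"
      by (rule has_field_derivative_transform_within[OF C1_time_derivative[OF e s], of 1])
        (use s x ze in auto)
    moreover have "at s within {0..T} \<noteq> bot"
      using s T by (simp add: trivial_limit_within islimpt_Icc)
    moreover have "((\<lambda>s. 0::real) has_real_derivative 0) (at s within {0..T})" by simp
    ultimately show ?thesis using has_field_derivative_unique by blast
  qed
  have zFx: "Fx j k t x = 0" if x: "norm x > R" for j k x
  proof -
    have "isCont (\<lambda>h. norm (x + h *\<^sub>R axis k 1)) 0" by (intro continuous_intros)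
    then have "((\<lambda>h. norm (x + h *\<^sub>R axis k 1)) \<longlongrightarrow> norm x) (at 0)"
      by (simp add: isCont_def)
    then have "\<forall>\<^sub>F h in at 0. norm (x + h *\<^sub>R axis k 1) > R"
      using x by (rule order_tendstoD)
    then have "\<forall>\<^sub>F h in nhds 0. norm (x + h *\<^sub>R axis k 1) > R"
      using x by (simp add: eventually_nhds_conv_at)
    then have ev: "\<forall>\<^sub>F h in nhds 0. F j t (x + h *\<^sub>R axis k 1) = 0"
      by eventually_elim (use zF t in auto)
    have "((\<lambda>h. 0::real) has_real_derivative Fx j k t x) (at 0)"
      using DERIV_cong_ev[OF refl ev refl] C1_space_derivative[OF F t] by metis
    then show ?thesis using DERIV_unique[of "\<lambda>h. 0::real" "Fx j k t x" 0 0] by simp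
  qed
  have eq: "(LINT x|lborel. e s x) = integral (cube R) (e s)" if "s \<in> {0..T}" for s
    using lebesgue_integral_eq_integral_cube[OF continuous_on_slice[OF C1_continuous(1)[OF e]], of s R R] ze that
    by simp
  have "((\<lambda>s. integral (cube R) (e s)) has_real_derivative integral (cube R) (et t)) (at t within {0..T})"
    unfolding cube_def
  proof (rule leibniz_rule_field_derivative)
    show "((\<lambda>s. e s x) has_real_derivative et s x) (at s within {0..T})" if "s \<in> {0..T}" for s x
      using C1_time_derivative[OF e that] .
    show "e s integrable_on cbox (- R *\<^sub>R One) (R *\<^sub>R One)" if "s \<in> {0..T}" for s
      by (intro integrable_continuous continuous_on_slice[OF C1_continuous(1)[OF e]] that)
    show "continuous_on ({0..T} \<times> cbox (- R *\<^sub>R One) (R *\<^sub>R One)) (\<lambda>(s, x). et s x)"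
      unfolding split_beta by (rule continuous_on_subset[OF C1_continuous(2)[OF e]]) auto
  qed (use t in auto)
  then have "((\<lambda>s. LINT x|lborel. e s x) has_real_derivative integral (cube R) (et t)) (at t within {0..T})"
    by (rule has_field_derivative_transform_within[of _ _ _ _ 1]) (use t eq in auto)
  also have "integral (cube R) (et t) = (LINT x|lborel. et t x)"
    using lebesgue_integral_eq_integral_cube[OF continuous_on_slice[OF C1_continuous(2)[OF e]], of t R R] zet t
    by simp
  finally have 1: "((\<lambda>s. LINT x|lborel. e s x) has_real_derivative (LINT x|lborel. et t x)) (at t within {0..T})" .
  have ie: "integrable lborel (et t)"
    by (rule integrable_compact_support[OF continuous_on_slice[OF C1_continuous(2)[OF e] t]]) (use zet t in auto)
  have iF: "integrable lborel (Fx j j t)" for j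
    by (rule integrable_compact_support[OF continuous_on_slice[OF C1_continuous(3)[OF F] t]]) (use zFx in auto)
  show "integrable lborel (\<lambda>x. et t x + (\<Sum>j\<in>UNIV. Fx j j t x))"
    using ie iF by simp
  have "(LINT x|lborel. Fx j j t x) = 0" for j
    by (rule lebesgue_integral_partial_derivative_eq_0[where f = "F j t" and a = "axis j 1" and R = R])
      (use zF zFx t C1_space_derivative[OF F t] in
        \<open>auto intro!: continuous_on_slice[OF C1_continuous(1)[OF F] t] continuous_on_slice[OF C1_continuous(3)[OF F] t]\<close>)
  then have "(LINT x|lborel. et t x + (\<Sum>j\<in>UNIV. Fx j j t x)) = (LINT x|lborel. et t x)"
    using ie iF by (simp add: Bochner_Integration.integral_add Bochner_Integration.integral_sum)
  then show "((\<lambda>s. LINT x|lborel. e s x) has_real_derivative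
           (LINT x|lborel. et t x + (\<Sum>j\<in>UNIV. Fx j j t x))) (at t within {0..T})"
    using 1 by simp
qed

section \<open>Calculus of one real variable\<close>

lemma nonincreasing_if_derivative_nonpos:
  fixes f :: "real \<Rightarrow> real"
  assumes "a \<le> c" and d: "\<And>t. t \<in> {a..c} \<Longrightarrow> (f has_real_derivative f' t) (at t within {a..c})"
    and "\<And>t. t \<in> {a..c} \<Longrightarrow> f' t \<le> 0"
  shows "f c \<le> f a"
proof (cases "a = c")
  case False
  show ?thesis
  proof (rule DERIV_nonpos_imp_decreasing_open[of a c f])
    show "a \<le> c" using False assms(1) by simp
    show "\<exists>y. (f has_real_derivative y) (at x) \<and> y \<le> 0" if "a < x" "x < c" for x
      using d[of x] assms(3)[of x] at_within_Icc_at[OF that] that by auto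
    show "continuous_on {a..c} f"
      using d DERIV_continuous_on by blast
  qed
qed simp

text \<open>A function that vanishes at \<open>a\<close> and whose derivative has the sign of \<open>s - a\<close> is positive away
  from \<open>a\<close>. Both inequalities on the internal energy below are of this kind.\<close>

lemma pos_if_derivative_points_away:
  fixes f :: "real \<Rightarrow> real"
  assumes "\<And>s. s \<in> closed_segment a c \<Longrightarrow> (f has_real_derivative f' s) (at s)"
    and "\<And>s. s \<in> open_segment a c \<Longrightarrow> (s - a) * f' s > 0"
    and "f a = 0" "c \<noteq> a"
  shows "f c > 0"
proof (cases "a < c")
  case True
  then have "\<exists>z>a. z < c \<and> f c - f a = (c - a) * f' z"
    by (intro MVT2) (use assms(1) in \<open>auto simp: closed_segment_eq_real_ivl\<close>)
  then obtain z where z: "a < z" "z < c" "f c - f a = (c - a) * f' z" by blast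
  then have "f' z > 0"
    using assms(2)[of z] by (simp add: open_segment_eq_real_ivl zero_less_mult_iff split: if_splits)
  then show ?thesis using z True assms(3) by simp
next
  case False
  with assms(4) have ca: "c < a" by simp
  then have "\<exists>z>c. z < a \<and> f a - f c = (a - c) * f' z"
    by (intro MVT2) (use assms(1) in \<open>auto simp: closed_segment_eq_real_ivl\<close>)
  then obtain z where z: "c < z" "z < a" "f a - f c = (a - c) * f' z" by blast
  then have "f' z < 0"
    using assms(2)[of z] ca by (auto simp add: open_segment_eq_real_ivl zero_less_mult_iff split: if_splits)
  then have "(a - c) * f' z < 0" using ca by (simp add: mult_pos_neg)
  then show ?thesis using z assms(3) by simp
qed

lemma isCont_abs_powr:
  fixes a :: real assumes "a > 0"
  shows "isCont (\<lambda>s. \<bar>s\<bar> powr a) s"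
proof -
  have "((\<lambda>s. \<bar>s\<bar> powr a) \<longlongrightarrow> \<bar>s\<bar> powr a) (at s)"
    by (rule tendsto_powr') (use assms in \<open>auto intro!: tendsto_intros\<close>)
  then show ?thesis by (simp add: isCont_def)
qed

text \<open>On negative arguments \<^const>\<open>powr\<close> is the even extension, since \<open>ln (- s) = ln s\<close>. For \<open>a > 1\<close> it is
  therefore continuously differentiable on the whole line, including at \<open>0\<close>. This makes the energy
  identity valid at every point of the slab, before anything is known about the sign of the density.\<close>

lemma DERIV_powr_real_line:
  fixes s a :: real assumes "a > 1"
  shows "((\<lambda>s. s powr a) has_real_derivative a * (sgn s * \<bar>s\<bar> powr (a - 1))) (at s)"
proof (cases s "0 :: real" rule: linorder_cases)
  case greater
  then show ?thesis by (auto intro!: derivative_eq_intros)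
next
  case less
  have "((\<lambda>s. (- s) powr a) has_real_derivative a * (sgn s * \<bar>s\<bar> powr (a - 1))) (at s)"
    using less by (auto intro!: derivative_eq_intros)
  then show ?thesis by (simp add: uminus_powr_eq)
next
  case equal
  have eq: "h powr a / h = sgn h * \<bar>h\<bar> powr (a - 1)" for h :: real
    by (cases h "0 :: real" rule: linorder_cases) (auto simp: powr_diff powr_minus_divide uminus_powr_eq)
  have "((\<lambda>h. \<bar>h\<bar> powr (a - 1)) \<longlongrightarrow> 0) (at (0::real))"
    using isCont_abs_powr[of "a - 1" 0] assms by (simp add: isCont_def)
  then have "((\<lambda>h. sgn h * \<bar>h\<bar> powr (a - 1)) \<longlongrightarrow> 0) (at (0::real))"
    by (rule Lim_null_comparison[rotated]) (auto intro!: always_eventually simp: abs_mult sgn_if)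
  then show ?thesis using equal by (simp add: DERIV_def eq)
qed

lemma isCont_sgn_powr:
  fixes a :: real assumes "a > 0"
  shows "isCont (\<lambda>s. sgn s * \<bar>s\<bar> powr a) s"
proof (cases "s = 0")
  case True
  have "((\<lambda>h. \<bar>h\<bar> powr a) \<longlongrightarrow> 0) (at (0::real))"
    using isCont_abs_powr[of a 0] assms by (simp add: isCont_def)
  then have "((\<lambda>h. sgn h * \<bar>h\<bar> powr a) \<longlongrightarrow> 0) (at (0::real))"
    by (rule Lim_null_comparison[rotated]) (auto intro!: always_eventually simp: abs_mult sgn_if)
  then show ?thesis using True by (simp add: isCont_def)
next
  case False
  then show ?thesis by (intro continuous_intros isCont_abs_powr assms) auto
qed

text \<open>The square of the positive part serves as a cut-off; it is continuously differentiable although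
  the positive part is not.\<close>

lemma DERIV_square_max_0: "((\<lambda>y::real. (max y 0)^2) has_real_derivative 2 * max y 0) (at y)"
proof (cases y "0 :: real" rule: linorder_cases)
  case less
  have ev: "\<forall>\<^sub>F z in nhds y. z \<in> {..<0}" by (rule eventually_nhds_in_open) (use less in auto)
  have "\<forall>\<^sub>F z in nhds y. (max z 0)^2 = 0" using ev by eventually_elim auto
  then show ?thesis using less DERIV_cong_ev[OF refl _ refl, of "\<lambda>y. (max y 0)^2" "\<lambda>y. 0" y 0] by simp
next
  case greater
  have ev: "\<forall>\<^sub>F z in nhds y. z \<in> {0<..}" by (rule eventually_nhds_in_open) (use greater in auto)
  have "\<forall>\<^sub>F z in nhds y. (max z 0)^2 = z^2" using ev by eventually_elim auto
  moreover have "((\<lambda>y. y^2) has_real_derivative 2 * max y 0) (at y)"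
    using greater by (auto intro!: derivative_eq_intros)
  ultimately show ?thesis using DERIV_cong_ev[OF refl _ refl, of "\<lambda>y. (max y 0)^2" "\<lambda>y. y^2" y] by blast
next
  case equal
  have "((\<lambda>h::real. (max h 0)^2 / h) \<longlongrightarrow> 0) (at 0)"
  proof (rule Lim_null_comparison)
    show "\<forall>\<^sub>F h::real in at 0. norm ((max h 0)^2 / h) \<le> \<bar>h\<bar>"
      by (auto intro!: always_eventually simp: max_def power2_eq_square)
    show "((\<lambda>h::real. \<bar>h\<bar>) \<longlongrightarrow> 0) (at 0)"
      by (rule tendsto_eq_intros | simp)+
  qed
  then show ?thesis using equal by (simp add: DERIV_def)
qed

lemma DERIV_square_min_0: "((\<lambda>y::real. (min y 0)^2) has_real_derivative 2 * min y 0) (at y)"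
proof -
  have "((\<lambda>y::real. (max (- y) 0)^2) has_real_derivative 2 * max (- y) 0 * - 1) (at y)"
    by (rule DERIV_chain2[OF DERIV_square_max_0]) (auto intro!: derivative_eq_intros)
  moreover have "max (- y) 0 = - min y 0" for y :: real by (auto simp: max_def min_def)
  ultimately show ?thesis by simp
qed

section \<open>The normalized pressure law\<close>

text \<open>Since \<open>p'(\<rho>bar) = c(\<rho>bar)\<^sup>2\<close>, the last assumption is the normalization of the sound speed.\<close>

locale normalized_gas =
  fixes A \<gamma> \<rho>bar :: real
  assumes A_pos: "A > 0" and \<gamma>_gt_1: "\<gamma> > 1" and \<rho>bar_pos: "\<rho>bar > 0"
    and sound_speed_1: "A * \<gamma> * \<rho>bar powr (\<gamma> - 1) = 1"
begin

abbreviation p :: "real \<Rightarrow> real" where "p \<equiv> pressure A \<gamma>"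

definition p' :: "real \<Rightarrow> real" where
  "p' s = A * \<gamma> * (sgn s * \<bar>s\<bar> powr (\<gamma> - 1))"

text \<open>The internal energy relative to the background: \<open>p/(\<gamma> - 1)\<close> minus its tangent at \<open>\<rho>bar\<close>, whose slope
  is \<open>1/(\<gamma> - 1)\<close> by the normalization. By convexity it is positive at every other
  density \<open>s \<ge> 0\<close>, and it vanishes to second order at \<open>\<rho>bar\<close>.\<close>

definition \<Phi> :: "real \<Rightarrow> real" where
  "\<Phi> s = (p s - p \<rho>bar - (s - \<rho>bar)) / (\<gamma> - 1)"

definition \<Phi>' :: "real \<Rightarrow> real" where
  "\<Phi>' s = (p' s - 1) / (\<gamma> - 1)"

lemma DERIV_p: "(p has_real_derivative p' s) (at s)"
  using DERIV_cmult[OF DERIV_powr_real_line[OF \<gamma>_gt_1], of A s]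
  by (simp add: pressure_def[abs_def] p'_def mult.assoc)

lemma continuous_p': "continuous_on UNIV p'"
proof -
  have "continuous_on UNIV (\<lambda>s. sgn s * \<bar>s\<bar> powr (\<gamma> - 1))"
    using isCont_sgn_powr[of "\<gamma> - 1"] \<gamma>_gt_1 by (simp add: continuous_on_eq_continuous_at)
  then show ?thesis unfolding p'_def[abs_def] by (rule continuous_on_mult_left)
qed

lemma p'_\<rho>bar: "p' \<rho>bar = 1"
  using sound_speed_1 \<rho>bar_pos by (simp add: p'_def)

lemma times_p': "s * p' s = \<gamma> * p s"
proof -
  have "s * p' s = A * \<gamma> * (\<bar>s\<bar> * \<bar>s\<bar> powr (\<gamma> - 1))"
    by (simp add: p'_def abs_if sgn_if)
  also have "\<bar>s\<bar> * \<bar>s\<bar> powr (\<gamma> - 1) = s powr \<gamma>"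
    by (simp add: powr_mult_base abs_if uminus_powr_eq)
  finally show ?thesis by (simp add: pressure_def)
qed

lemma p'_strict_mono: "0 \<le> s \<Longrightarrow> s < t \<Longrightarrow> p' s < p' t"
  using A_pos \<gamma>_gt_1 powr_less_mono2[of "\<gamma> - 1" s t]
  by (cases "s = 0") (auto simp: p'_def)

lemma DERIV_\<Phi>: "(\<Phi> has_real_derivative \<Phi>' s) (at s)"
  unfolding \<Phi>_def[abs_def] \<Phi>'_def using \<gamma>_gt_1
  by (auto intro!: derivative_eq_intros DERIV_p)

lemma continuous_\<Phi>': "continuous_on UNIV \<Phi>'"
  unfolding \<Phi>'_def using \<gamma>_gt_1 by (intro continuous_intros continuous_p') auto

lemma \<Phi>_\<rho>bar: "\<Phi> \<rho>bar = 0"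
  by (simp add: \<Phi>_def)

lemma \<Phi>'_\<rho>bar: "\<Phi>' \<rho>bar = 0"
  by (simp add: \<Phi>'_def p'_\<rho>bar)

lemma \<Phi>'_points_away:
  assumes "s \<ge> 0" "s \<noteq> \<rho>bar"
  shows "(s - \<rho>bar) * \<Phi>' s > 0"
  using p'_strict_mono[of s \<rho>bar] p'_strict_mono[of \<rho>bar s] \<rho>bar_pos \<gamma>_gt_1 assms p'_\<rho>bar
  by (cases "s < \<rho>bar") (auto simp: \<Phi>'_def zero_less_mult_iff zero_less_divide_iff divide_less_0_iff)

lemma \<Phi>_pos:
  assumes "s \<ge> 0" "s \<noteq> \<rho>bar"
  shows "\<Phi> s > 0"
proof (rule pos_if_derivative_points_away[where a = \<rho>bar and c = s and f = \<Phi> and f' = \<Phi>'])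
  fix z assume z: "z \<in> open_segment \<rho>bar s"
  show "(z - \<rho>bar) * \<Phi>' z > 0"
    by (rule \<Phi>'_points_away)
      (use z assms(1) \<rho>bar_pos in \<open>auto simp: open_segment_eq_real_ivl split: if_splits\<close>)
qed (use assms in \<open>auto intro: DERIV_\<Phi> simp: \<Phi>_\<rho>bar\<close>)

lemma p_above_tangent: "s \<ge> 0 \<Longrightarrow> p s - p \<rho>bar \<ge> s - \<rho>bar"
  using \<Phi>_pos[of s] \<gamma>_gt_1 by (cases "s = \<rho>bar") (auto simp: \<Phi>_def zero_less_divide_iff)

text \<open>Near the background, acoustic energy is transported at a speed close to \<open>1\<close>. Both sides vanish to
  second order at \<open>\<rho>bar\<close>, and because \<open>s \<Phi>''(s) = p'(s)\<close>, their difference has the derivative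
  \<open>\<Phi>' (K - \<Phi>'/2 - p')\<close>. The bracket is close to \<open>K - 1 > 0\<close>, so this has the sign of \<open>s - \<rho>bar\<close>.\<close>

lemma \<Phi>_dominates_near_\<rho>bar:
  assumes "K > 1"
  obtains \<eta> where "\<eta> > 0" "\<And>s. \<bar>s - \<rho>bar\<bar> < \<eta> \<Longrightarrow> s > 0 \<and> s * (\<Phi>' s)^2 / 2 \<le> K * \<Phi> s"
proof -
  let ?q = "\<lambda>s. K - \<Phi>' s / 2 - p' s"
  have "isCont ?q \<rho>bar"
    using continuous_p' continuous_\<Phi>'
    by (intro continuous_intros) (auto simp: continuous_on_eq_continuous_at)
  then have "(?q \<longlongrightarrow> K - 1) (at \<rho>bar)" by (simp add: isCont_def \<Phi>'_\<rho>bar p'_\<rho>bar)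
  then have "\<forall>\<^sub>F s in at \<rho>bar. ?q s > 0" by (rule order_tendstoD) (use assms in simp)
  then obtain d where d: "d > 0" "\<And>s. s \<noteq> \<rho>bar \<Longrightarrow> \<bar>s - \<rho>bar\<bar> < d \<Longrightarrow> ?q s > 0"
    unfolding eventually_at by (auto simp: dist_real_def)
  let ?k = "\<lambda>s. K * \<Phi> s - s * (\<Phi>' s)^2 / 2"
  show thesis
  proof (rule that[of "min d \<rho>bar"])
    fix s assume s: "\<bar>s - \<rho>bar\<bar> < min d \<rho>bar"
    then have "s > 0" by auto
    moreover have "?k s \<ge> 0"
    proof (cases "s = \<rho>bar")
      case False
      have "?k s > 0"
      proof (rule pos_if_derivative_points_away[where a = \<rho>bar and c = s and f = ?k and f' = "\<lambda>s. \<Phi>' s * ?q s"])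
        fix z assume "z \<in> closed_segment \<rho>bar s"
        then have z: "z > 0"
          using \<open>s > 0\<close> \<rho>bar_pos by (auto simp: closed_segment_eq_real_ivl split: if_splits)
        have "((\<lambda>s. A * \<gamma> * s powr (\<gamma> - 1)) has_real_derivative
            A * \<gamma> * ((\<gamma> - 1) * z powr (\<gamma> - 2))) (at z)"
          using z by (auto intro!: derivative_eq_intros)
        moreover have "\<forall>\<^sub>F s in nhds z. s \<in> {0<..}"
          by (rule eventually_nhds_in_open) (use z in auto)
        then have "\<forall>\<^sub>F s in nhds z. A * \<gamma> * s powr (\<gamma> - 1) = p' s"
          by eventually_elim (simp add: p'_def)
        ultimately have "(p' has_real_derivative A * \<gamma> * ((\<gamma> - 1) * z powr (\<gamma> - 2))) (at z)"
          using DERIV_cong_ev[OF refl _ refl, of "\<lambda>s. A * \<gamma> * s powr (\<gamma> - 1)" p' z] by blast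
        then have d\<Phi>': "(\<Phi>' has_real_derivative A * \<gamma> * z powr (\<gamma> - 2)) (at z)"
          unfolding \<Phi>'_def[abs_def] using \<gamma>_gt_1
          by (auto intro!: derivative_eq_intros)
        have zp: "z * (A * \<gamma> * z powr (\<gamma> - 2)) = p' z"
          using z by (simp add: p'_def powr_diff power2_eq_square)
        have "(?k has_real_derivative
            K * \<Phi>' z - ((\<Phi>' z)^2 + z * (2 * \<Phi>' z * (A * \<gamma> * z powr (\<gamma> - 2)))) / 2) (at z)"
          by (auto intro!: derivative_eq_intros DERIV_\<Phi> d\<Phi>')
        also have "K * \<Phi>' z - ((\<Phi>' z)^2 + z * (2 * \<Phi>' z * (A * \<gamma> * z powr (\<gamma> - 2)))) / 2
            = K * \<Phi>' z - (\<Phi>' z)^2 / 2 - \<Phi>' z * (z * (A * \<gamma> * z powr (\<gamma> - 2)))"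
          by (simp add: field_simps)
        also have "\<dots> = \<Phi>' z * ?q z"
          unfolding zp by (simp add: field_simps power2_eq_square)
        finally show "(?k has_real_derivative \<Phi>' z * ?q z) (at z)" .
      next
        fix z assume z: "z \<in> open_segment \<rho>bar s"
        then have "z \<noteq> \<rho>bar" "\<bar>z - \<rho>bar\<bar> < d" "z \<ge> 0"
          using s \<open>s > 0\<close> \<rho>bar_pos by (auto simp: open_segment_eq_real_ivl split: if_splits)
        then show "(z - \<rho>bar) * (\<Phi>' z * ?q z) > 0"
          using d(2) \<Phi>'_points_away[of z] by (simp add: mult.assoc[symmetric])
      qed (use False in \<open>auto simp: \<Phi>_\<rho>bar \<Phi>'_\<rho>bar\<close>)
      then show ?thesis by simp
    qed (simp add: \<Phi>_\<rho>bar \<Phi>'_\<rho>bar)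
    ultimately show "s > 0 \<and> s * (\<Phi>' s)^2 / 2 \<le> K * \<Phi> s" by simp
  qed (use d \<rho>bar_pos in simp)
qed

end

section \<open>The energy of the damped Euler system\<close>

text \<open>The pointwise algebra of the energy law, with \<open>aij = \<partial>\<^sub>jv\<^sub>i\<close>, \<open>g = \<gamma>\<close> and \<open>c = 1/(g - 1)\<close>: the \<open>i\<close>-th momentum
  equation is multiplied by \<open>v\<^sub>i\<close>, the continuity equation by \<open>c (P' - 1) - q/2\<close>, and the pressure terms
  that remain cancel by \<open>r P' = g P\<close>.\<close>

lemma energy_identity:
  fixes r rt c g b P P' v1 v2 v3 :: real
  assumes cont: "rt + (rx1 * v1 + r * a11 + (rx2 * v2 + r * a22) + (rx3 * v3 + r * a33)) = 0" (is "?C = 0")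
    and m1: "rt * v1 + r * vt1 + ((rx1 * v1 + r * a11) * v1 + r * v1 * a11 + ((rx2 * v1 + r * a12) * v2 + r * v1 * a22) + ((rx3 * v1 + r * a13) * v3 + r * v1 * a33)) + P' * rx1 = - b * (r * v1)" (is "?M1 = _")
    and m2: "rt * v2 + r * vt2 + ((rx1 * v2 + r * a21) * v1 + r * v2 * a11 + ((rx2 * v2 + r * a22) * v2 + r * v2 * a22) + ((rx3 * v2 + r * a23) * v3 + r * v2 * a33)) + P' * rx2 = - b * (r * v2)" (is "?M2 = _")
    and m3: "rt * v3 + r * vt3 + ((rx1 * v3 + r * a31) * v1 + r * v3 * a11 + ((rx2 * v3 + r * a32) * v2 + r * v3 * a22) + ((rx3 * v3 + r * a33) * v3 + r * v3 * a33)) + P' * rx3 = - b * (r * v3)" (is "?M3 = _")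
    and c: "c * (g - 1) = 1" and P: "r * P' = g * P"
    and q: "q = v1 * v1 + v2 * v2 + v3 * v3"
  shows "rt * q / 2 + r * (v1 * vt1 + v2 * vt2 + v3 * vt3) + c * (P' - 1) * rt
     + (a11 * (r * q / 2 + c * (g * P - r))
         + v1 * (rx1 * q / 2 + r * (v1 * a11 + v2 * a21 + v3 * a31) + c * (g * P' - 1) * rx1)
      + (a22 * (r * q / 2 + c * (g * P - r))
         + v2 * (rx2 * q / 2 + r * (v1 * a12 + v2 * a22 + v3 * a32) + c * (g * P' - 1) * rx2))
      + (a33 * (r * q / 2 + c * (g * P - r))
         + v3 * (rx3 * q / 2 + r * (v1 * a13 + v2 * a23 + v3 * a33) + c * (g * P' - 1) * rx3)))
     = - b * r * q" (is "?L = ?R")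
proof -
  have "?L = v1 * ?M1 + v2 * ?M2 + v3 * ?M3 - q * ?C
      + (c * (P' - 1) + q / 2) * ?C
      + c * (a11 + a22 + a33) * (g * P - r * P')
      + (c * (g - 1) - 1) * (P' * (v1 * rx1 + v2 * rx2 + v3 * rx3))"
    unfolding q by (simp add: field_simps)
  also have "\<dots> = v1 * (- b * (r * v1)) + v2 * (- b * (r * v2)) + v3 * (- b * (r * v3))"
    by (subst m1, subst m2, subst m3, subst cont, subst cont, subst P, subst c, simp)
  also have "\<dots> = ?R" unfolding q by (simp add: algebra_simps)
  finally show ?thesis .
qed

text \<open>The system written out in partial derivatives, with \<open>vx i j = \<partial>\<^sub>jv\<^sub>i\<close> and a general nonnegative
  damping coefficient \<open>b t\<close>. The momentum equation is expanded by the product rule but still in conservation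
  form; it has not been divided by the density, so it makes sense at a vacuum.\<close>

locale damped_euler = normalized_gas A \<gamma> \<rho>bar for A \<gamma> \<rho>bar :: real +
  fixes T :: real and b :: "real \<Rightarrow> real"
    and r :: "real \<Rightarrow> real^3 \<Rightarrow> real" and v :: "3 \<Rightarrow> real \<Rightarrow> real^3 \<Rightarrow> real"
    and rt :: "real \<Rightarrow> real^3 \<Rightarrow> real" and rx :: "3 \<Rightarrow> real \<Rightarrow> real^3 \<Rightarrow> real"
    and vt :: "3 \<Rightarrow> real \<Rightarrow> real^3 \<Rightarrow> real" and vx :: "3 \<Rightarrow> 3 \<Rightarrow> real \<Rightarrow> real^3 \<Rightarrow> real"
  assumes T_pos: "T > 0" and b_nonneg: "t \<in> {0..T} \<Longrightarrow> b t \<ge> 0"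
    and r_C1: "has_C1_partials T r rt rx"
    and v_C1: "has_C1_partials T (v i) (vt i) (vx i)"
    and continuity: "t \<in> {0..T} \<Longrightarrow>
      rt t x + (\<Sum>j\<in>UNIV. rx j t x * v j t x + r t x * vx j j t x) = 0"
    and momentum: "t \<in> {0..T} \<Longrightarrow>
      rt t x * v i t x + r t x * vt i t x
      + (\<Sum>j\<in>UNIV. (rx j t x * v i t x + r t x * vx i j t x) * v j t x + r t x * v i t x * vx j j t x)
      + p' (r t x) * rx i t x = - b t * (r t x * v i t x)"
begin

definition speed2 :: "real \<Rightarrow> real^3 \<Rightarrow> real" where
  "speed2 t x = (\<Sum>i\<in>UNIV. v i t x * v i t x)"

definition energy :: "real \<Rightarrow> real^3 \<Rightarrow> real" where
  "energy t x = r t x * speed2 t x / 2 + \<Phi> (r t x)"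

text \<open>With \<open>\<rho>\<Phi>'(\<rho>) = (\<gamma>p - \<rho>)/(\<gamma> - 1)\<close> (\<open>enthalpy_eq\<close> below) this flux is continuously differentiable, although
  \<open>\<Phi>'\<close> itself need not be differentiable at \<open>0\<close> when \<open>\<gamma> < 2\<close>.\<close>

definition energy_flux :: "3 \<Rightarrow> real \<Rightarrow> real^3 \<Rightarrow> real" where
  "energy_flux j t x = v j t x * (r t x * speed2 t x / 2 + r t x * \<Phi>' (r t x))"

lemma speed2_nonneg: "speed2 t x \<ge> 0"
  unfolding speed2_def by (intro sum_nonneg) auto

lemma speed2_C1:
  "has_C1_partials T speed2 (\<lambda>t x. 2 * (\<Sum>i\<in>UNIV. v i t x * vt i t x))
     (\<lambda>j t x. 2 * (\<Sum>i\<in>UNIV. v i t x * vx i j t x))"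
  unfolding speed2_def[abs_def]
  by (rule C1_rhs[OF C1_sum[OF C1_mult[OF v_C1 v_C1]]])
    (simp_all add: sum_distrib_left algebra_simps sum.distrib)

lemma energy_C1:
  "has_C1_partials T energy
    (\<lambda>t x. rt t x * speed2 t x / 2 + r t x * (\<Sum>i\<in>UNIV. v i t x * vt i t x) + \<Phi>' (r t x) * rt t x)
    (\<lambda>j t x. rx j t x * speed2 t x / 2 + r t x * (\<Sum>i\<in>UNIV. v i t x * vx i j t x) + \<Phi>' (r t x) * rx j t x)"
proof -
  have "has_C1_partials T energy
    (\<lambda>t x. 1/2 * (rt t x * speed2 t x + r t x * (2 * (\<Sum>i\<in>UNIV. v i t x * vt i t x))) + \<Phi>' (r t x) * rt t x)
    (\<lambda>j t x. 1/2 * (rx j t x * speed2 t x + r t x * (2 * (\<Sum>i\<in>UNIV. v i t x * vx i j t x))) + \<Phi>' (r t x) * rx j t x)"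
    using C1_add[OF C1_cmult[OF C1_mult[OF r_C1 speed2_C1], of "1/2"] C1_compose[OF r_C1 DERIV_\<Phi> continuous_\<Phi>']]
    by (simp add: energy_def[abs_def])
  then show ?thesis by (rule C1_rhs) (simp_all add: field_simps)
qed

definition enthalpy :: "real \<Rightarrow> real" where
  "enthalpy s = (\<gamma> * p s - s) / (\<gamma> - 1)"

lemma enthalpy_eq: "enthalpy s = s * \<Phi>' s"
  using times_p'[of s] by (simp add: enthalpy_def \<Phi>'_def algebra_simps)

lemma DERIV_enthalpy: "(enthalpy has_real_derivative (\<gamma> * p' s - 1) / (\<gamma> - 1)) (at s)"
  unfolding enthalpy_def[abs_def] using \<gamma>_gt_1
  by (auto intro!: derivative_eq_intros DERIV_p)

lemma energy_flux_C1:
  "has_C1_partials T (energy_flux j)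
    (\<lambda>t x. vt j t x * (r t x * speed2 t x / 2 + enthalpy (r t x)) +
      v j t x * (rt t x * speed2 t x / 2 + r t x * (\<Sum>i\<in>UNIV. v i t x * vt i t x) + (\<gamma> * p' (r t x) - 1) / (\<gamma> - 1) * rt t x))
    (\<lambda>k t x. vx j k t x * (r t x * speed2 t x / 2 + enthalpy (r t x)) +
      v j t x * (rx k t x * speed2 t x / 2 + r t x * (\<Sum>i\<in>UNIV. v i t x * vx i k t x) + (\<gamma> * p' (r t x) - 1) / (\<gamma> - 1) * rx k t x))"
proof -
  have c: "continuous_on UNIV (\<lambda>s. (\<gamma> * p' s - 1) / (\<gamma> - 1))"
    using \<gamma>_gt_1 by (intro continuous_intros continuous_p') auto
  have "has_C1_partials T (\<lambda>t x. v j t x * (1/2 * (r t x * speed2 t x) + enthalpy (r t x)))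
    (\<lambda>t x. vt j t x * (1/2 * (r t x * speed2 t x) + enthalpy (r t x)) + v j t x *
      (1/2 * (rt t x * speed2 t x + r t x * (2 * (\<Sum>i\<in>UNIV. v i t x * vt i t x))) + (\<gamma> * p' (r t x) - 1) / (\<gamma> - 1) * rt t x))
    (\<lambda>k t x. vx j k t x * (1/2 * (r t x * speed2 t x) + enthalpy (r t x)) + v j t x *
      (1/2 * (rx k t x * speed2 t x + r t x * (2 * (\<Sum>i\<in>UNIV. v i t x * vx i k t x))) + (\<gamma> * p' (r t x) - 1) / (\<gamma> - 1) * rx k t x))"
    by (rule C1_mult[OF v_C1 C1_add[OF C1_cmult[OF C1_mult[OF r_C1 speed2_C1], of "1/2"] C1_compose[OF r_C1 DERIV_enthalpy c]]])
  also have "(\<lambda>t x. v j t x * (1/2 * (r t x * speed2 t x) + enthalpy (r t x))) = energy_flux j"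
    by (simp add: fun_eq_iff energy_flux_def enthalpy_eq)
  finally show ?thesis by (rule C1_rhs) (simp_all add: field_simps)
qed

text \<open>The energy law \<open>\<partial>\<^sub>te + div F = - b \<rho> |u|\<^sup>2\<close>. The partial derivatives are existentially quantified because
  only this combination of them is ever used.\<close>

lemma energy_balance:
  obtains et ex Ft Fx where "has_C1_partials T energy et ex"
    "\<And>j. has_C1_partials T (energy_flux j) (Ft j) (Fx j)"
    "\<And>t x. t \<in> {0..T} \<Longrightarrow> et t x + (\<Sum>j\<in>UNIV. Fx j j t x) = - b t * r t x * speed2 t x"
proof (rule that[OF energy_C1 energy_flux_C1])
  fix t x assume t: "t \<in> {0..T}"
  have c: "1 / (\<gamma> - 1) * (\<gamma> - 1) = 1" using \<gamma>_gt_1 by simp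
  from energy_identity[OF continuity[OF t, of x, unfolded sum_3] momentum[OF t, of x 1, unfolded sum_3]
     momentum[OF t, of x 2, unfolded sum_3] momentum[OF t, of x 3, unfolded sum_3] c times_p' speed2_def[of t x, unfolded sum_3]]
  show "rt t x * speed2 t x / 2 + r t x * (\<Sum>i\<in>UNIV. v i t x * vt i t x) + \<Phi>' (r t x) * rt t x
    + (\<Sum>j\<in>UNIV. vx j j t x * (r t x * speed2 t x / 2 + enthalpy (r t x)) +
      v j t x * (rx j t x * speed2 t x / 2 + r t x * (\<Sum>i\<in>UNIV. v i t x * vx i j t x) + (\<gamma> * p' (r t x) - 1) / (\<gamma> - 1) * rx j t x))
    = - b t * r t x * speed2 t x"
    unfolding sum_3 \<Phi>'_def enthalpy_def by simp
qed

end

section \<open>Finite propagation speed\<close>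

text \<open>In a state with \<open>|u| = q \<le> s - 1\<close> the energy flux is at most \<open>s\<close> times the energy density: \<open>s - 1\<close> of
  this is convection with the flow, the rest is the mixed term, split by Young's inequality.\<close>

lemma energy_flux_bound:
  fixes q \<rho> \<phi> F s :: real
  assumes "0 \<le> q" "q \<le> s - 1" "0 \<le> \<rho>" "\<rho> * \<phi>^2 / 2 \<le> s * F"
  shows "q * (\<rho> * q^2 / 2 + \<rho> * \<bar>\<phi>\<bar>) \<le> s * (\<rho> * q^2 / 2 + F)"
proof -
  have "q * (\<rho> * q^2 / 2) \<le> (s - 1) * (\<rho> * q^2 / 2)"
    using assms by (intro mult_right_mono) auto
  moreover have "0 \<le> \<rho> * (q - \<bar>\<phi>\<bar>)^2 / 2" using assms by simp
  then have "q * (\<rho> * \<bar>\<phi>\<bar>) \<le> \<rho> * q^2 / 2 + \<rho> * \<phi>^2 / 2"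
    by (simp add: power2_diff algebra_simps)
  ultimately show ?thesis using assms(4) by (simp add: algebra_simps)
qed

context damped_euler
begin

definition velocity :: "real \<Rightarrow> real^3 \<Rightarrow> real^3" where
  "velocity t x = (\<chi> i. v i t x)"

lemma norm_velocity: "(norm (velocity t x))^2 = speed2 t x"
  by (simp add: power2_norm_eq_inner inner_vec_def velocity_def speed2_def)

lemma restrict_time:
  assumes "0 < T'" "T' \<le> T"
  shows "damped_euler A \<gamma> \<rho>bar T' b r v rt rx vt vx"
proof unfold_locales
  show "has_C1_partials T' r rt rx" "has_C1_partials T' (v i) (vt i) (vx i)" for i
    using C1_restrict[OF _ assms(2)] r_C1 v_C1 by auto
qed (use assms b_nonneg continuity momentum in auto)

text \<open>Local energy argument in the backward cone \<open>|x - x0| < |x0| - M - s t\<close>, whose base lies where the initial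
  state is constant. The energy in the time slices is measured with the weight \<open>\<theta> = (max \<psi> 0)\<^sup>2\<close>, where
  \<open>\<psi> = (rad t)\<^sup>2 - |x - x0|\<^sup>2\<close> is positive exactly inside the cone. As long as the state is close to the
  background there, energy travels slower than \<open>s\<close>, so the weighted energy cannot grow and stays zero.
  Closeness is not an assumption: on the compact cone the solution is uniformly continuous, so if the
  state is constant up to some time, it stays close for a further step of fixed length, hence is constant
  during that step as well.\<close>

lemma constant_state_at_tip_of_cone:
  assumes init: "\<And>x. norm x > M \<Longrightarrow> r 0 x = \<rho>bar" "\<And>x i. norm x > M \<Longrightarrow> v i 0 x = 0"
    and s: "s > 1" and x0: "norm x0 > M + s * T"
  shows "r T x0 = \<rho>bar \<and> (\<forall>i. v i T x0 = 0)"
proof -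
  define a where "a = norm x0 - M"
  define rad where "rad t = a - s * t" for t
  define \<psi> where "\<psi> t x = (rad t)^2 - (\<Sum>i\<in>UNIV. (x $ i - x0 $ i) * (x $ i - x0 $ i))" for t and x :: "real^3"
  define \<theta> where "\<theta> t x = (max (\<psi> t x) 0)^2" for t x
  define \<omega> where "\<omega> t x = max (\<psi> t x) 0" for t x
  have rad_pos: "rad t > 0" if "t \<in> {0..T}" for t
  proof -
    have "s * t \<le> s * T" using that s by simp
    then show ?thesis using x0 by (simp add: rad_def a_def)
  qed
  have rad_le: "rad t \<le> rad t'" if "t' \<le> t" for t t'
    using that s by (simp add: rad_def)
  have \<psi>_norm: "\<psi> t x = (rad t)^2 - (norm (x - x0))^2" for t x
    by (simp add: \<psi>_def power2_norm_eq_inner inner_vec_def)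
  have \<psi>_pos: "\<psi> t x > 0 \<longleftrightarrow> norm (x - x0) < rad t" if "t \<in> {0..T}" for t x
    using rad_pos[OF that] unfolding \<psi>_norm by (auto simp: power2_less_imp_less intro!: power_strict_mono)
  have \<theta>_0: "\<theta> t x = 0" if "t \<in> {0..T}" "norm x > norm x0 + a" for t x
  proof -
    have "rad t \<le> a" using rad_le[of 0 t] that by (simp add: rad_def)
    moreover have "norm x \<le> norm (x - x0) + norm x0"
      using norm_triangle_ineq[of "x - x0" x0] by simp
    ultimately have "\<not> norm (x - x0) < rad t" using that(2) by linarith
    then have "\<psi> t x \<le> 0" using \<psi>_pos[OF that(1), of x] by linarith
    then show ?thesis by (simp add: \<theta>_def)
  qed
  have "has_C1_partials T \<psi> (\<lambda>t x. 2 * rad t * (- s)) (\<lambda>j t x. - 2 * (x $ j - x0 $ j))"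
  proof -
    have 1: "has_C1_partials T (\<lambda>t x. (rad t)^2) (\<lambda>t x. 2 * rad t * (- s)) (\<lambda>j t x. 0)"
      by (rule C1_time) (auto simp: rad_def intro!: derivative_eq_intros continuous_intros)
    have c: "has_C1_partials T (\<lambda>t x. x $ i - x0 $ i) (\<lambda>t x. 0) (\<lambda>j t x. if i = j then 1 else 0)" for i
      by (rule C1_rhs[OF C1_diff[OF C1_coordinate C1_const]]) auto
    show ?thesis
      unfolding \<psi>_def[abs_def]
      by (rule C1_rhs[OF C1_diff[OF 1 C1_sum[OF C1_mult[OF c c]]]])
        (auto simp: if_distrib[of "\<lambda>y. y * _"] if_distrib[of "\<lambda>y. _ * y"] sum.distrib cong: if_cong)
  qed
  moreover have "continuous_on UNIV (\<lambda>y::real. 2 * max y 0)" by (intro continuous_intros)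
  ultimately
  have \<theta>_C1: "has_C1_partials T \<theta> (\<lambda>t x. 2 * \<omega> t x * (2 * rad t * (- s))) (\<lambda>j t x. 2 * \<omega> t x * (- 2 * (x $ j - x0 $ j)))"
    unfolding \<theta>_def[abs_def] \<omega>_def[abs_def] by (rule C1_compose[OF _ DERIV_square_max_0])
  obtain et ex Ft Fx where e: "has_C1_partials T energy et ex"
    and F: "\<And>j. has_C1_partials T (energy_flux j) (Ft j) (Fx j)"
    and bal: "\<And>t x. t \<in> {0..T} \<Longrightarrow> et t x + (\<Sum>j\<in>UNIV. Fx j j t x) = - b t * r t x * speed2 t x"
    using energy_balance by blast
  define E where "E t = (LINT x|lborel. \<theta> t x * energy t x)" for t
  define D where "D t x = (2 * \<omega> t x * (2 * rad t * (- s)) * energy t x + \<theta> t x * et t x)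
     + (\<Sum>j\<in>UNIV. 2 * \<omega> t x * (- 2 * (x $ j - x0 $ j)) * energy_flux j t x + \<theta> t x * Fx j j t x)" for t x
  have dE: "(E has_real_derivative (LINT x|lborel. D t x)) (at t within {0..T})"
    if "t \<in> {0..T}" for t
    unfolding E_def[abs_def] D_def
    by (rule balance_law(1)[OF T_pos C1_mult[OF \<theta>_C1 e] C1_mult[OF \<theta>_C1 F], where R = "norm x0 + a"])
      (use that \<theta>_0 in auto)
  obtain \<eta> where \<eta>: "\<eta> > 0"
    "\<And>y. \<bar>y - \<rho>bar\<bar> < \<eta> \<Longrightarrow> y > 0 \<and> y * (\<Phi>' y)^2 / 2 \<le> s * \<Phi> y"
    using \<Phi>_dominates_near_\<rho>bar[OF s] by blast
  \<comment> \<open>Below \<open>\<eta>\<close> the acoustic bound holds, below \<open>s - 1\<close> convection is slow enough.\<close>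
  define \<epsilon> where "\<epsilon> = min \<eta> (s - 1)"
  define N where "N t x = \<bar>r t x - \<rho>bar\<bar> + norm (velocity t x)" for t x
  have N_0: "N t x = 0 \<longleftrightarrow> r t x = \<rho>bar \<and> (\<forall>i. v i t x = 0)" for t x
    by (auto simp: N_def velocity_def vec_eq_iff add_nonneg_eq_0_iff)
  define small where "small t \<longleftrightarrow> (\<forall>x. norm (x - x0) < rad t \<longrightarrow> N t x < \<epsilon>)" for t
  define quiet where "quiet t \<longleftrightarrow> (\<forall>x. norm (x - x0) < rad t \<longrightarrow> N t x = 0)" for t
  have energy_0: "energy t x = 0" if "N t x = 0" for t x
    using that by (simp add: N_0 energy_def speed2_def \<Phi>_\<rho>bar)
  \<comment> \<open>Inside the cone the energy loss through the shrinking weight beats the flux; outside, the weight and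
    its derivatives vanish.\<close>
  have D_nonpos: "D t x \<le> 0" if t: "t \<in> {0..T}" and "small t" for t x
  proof (cases "norm (x - x0) < rad t")
    case False
    then have "\<psi> t x \<le> 0" using \<psi>_pos[OF t, of x] by linarith
    then show ?thesis by (simp add: D_def \<theta>_def \<omega>_def)
  next
    case True
    then have "N t x < \<epsilon>" using that by (simp add: small_def)
    then have sm: "\<bar>r t x - \<rho>bar\<bar> < \<eta>" "norm (velocity t x) \<le> s - 1"
      unfolding N_def \<epsilon>_def using norm_ge_zero[of "velocity t x"] by linarith+
    then have r: "r t x > 0" "r t x * (\<Phi>' (r t x))^2 / 2 \<le> s * \<Phi> (r t x)" using \<eta>(2) by auto
    let ?G = "r t x * speed2 t x / 2 + r t x * \<Phi>' (r t x)"
    let ?q = "norm (velocity t x)"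
    have "- ((x - x0) \<bullet> velocity t x * ?G) \<le> \<bar>(x - x0) \<bullet> velocity t x\<bar> * \<bar>?G\<bar>"
      by (metis abs_ge_minus_self abs_mult)
    also have "\<dots> \<le> (rad t * ?q) * (r t x * ?q^2 / 2 + r t x * \<bar>\<Phi>' (r t x)\<bar>)"
    proof (rule mult_mono)
      show "\<bar>(x - x0) \<bullet> velocity t x\<bar> \<le> rad t * ?q"
        using Cauchy_Schwarz_ineq2[of "x - x0" "velocity t x"] True
        by (meson less_imp_le mult_right_mono norm_ge_zero order_trans)
      have "\<bar>?G\<bar> \<le> \<bar>r t x * speed2 t x / 2\<bar> + \<bar>r t x * \<Phi>' (r t x)\<bar>" by (rule abs_triangle_ineq)
      then show "\<bar>?G\<bar> \<le> r t x * ?q^2 / 2 + r t x * \<bar>\<Phi>' (r t x)\<bar>"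
        using r(1) speed2_nonneg by (simp add: norm_velocity abs_mult)
    qed (use rad_pos[OF t] in auto)
    also have "\<dots> = rad t * (?q * (r t x * ?q^2 / 2 + r t x * \<bar>\<Phi>' (r t x)\<bar>))" by simp
    also have "\<dots> \<le> rad t * (s * (r t x * ?q^2 / 2 + \<Phi> (r t x)))"
      using energy_flux_bound[of ?q s "r t x" "\<Phi>' (r t x)" "\<Phi> (r t x)"] r sm rad_pos[OF t]
      by (intro mult_left_mono) auto
    finally have flux: "- ((x - x0) \<bullet> velocity t x * ?G) \<le> rad t * (s * energy t x)"
      by (simp add: energy_def norm_velocity)
    have Geq: "(x - x0) \<bullet> velocity t x * ?G = (\<Sum>j\<in>UNIV. (x $ j - x0 $ j) * energy_flux j t x)"
      by (simp add: inner_vec_def velocity_def energy_flux_def sum_distrib_right mult.assoc)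
    \<comment> \<open>\<open>\<psi>\<close> decreases in time at the rate \<open>2 s (rad t)\<close> and has the gradient \<open>- 2 (x - x0)\<close>, of length less than
      \<open>2 (rad t)\<close>; this is where the flux bound meets the slope of the cone.\<close>
    have "D t x = 4 * \<omega> t x * (- ((x - x0) \<bullet> velocity t x * ?G) - rad t * (s * energy t x))
        + \<theta> t x * (et t x + (\<Sum>j\<in>UNIV. Fx j j t x))"
      unfolding Geq D_def sum_3 by (simp add: algebra_simps)
    also have "\<dots> \<le> 0"
    proof -
      have "4 * \<omega> t x * (- ((x - x0) \<bullet> velocity t x * ?G) - rad t * (s * energy t x)) \<le> 0"
        using flux by (intro mult_nonneg_nonpos) (auto simp: \<omega>_def)
      moreover have "\<theta> t x * (et t x + (\<Sum>j\<in>UNIV. Fx j j t x)) \<le> 0"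
      proof -
        have "b t * r t x * speed2 t x \<ge> 0"
          using b_nonneg[OF t] r(1) speed2_nonneg by simp
        then show ?thesis
          using mult_nonneg_nonpos[of "\<theta> t x" "- b t * r t x * speed2 t x"]
          unfolding bal[OF t] by (simp add: \<theta>_def)
      qed
      ultimately show ?thesis by simp
    qed
    finally show ?thesis .
  qed
  have quiet_0: "quiet 0"
    unfolding quiet_def
  proof (intro allI impI)
    fix x assume "norm (x - x0) < rad 0"
    moreover have "norm x0 \<le> norm x + norm (x - x0)"
      using norm_triangle_ineq4[of x "x - x0"] by simp
    ultimately have "norm x > M" by (simp add: rad_def a_def)
    then show "N 0 x = 0" using init by (simp add: N_0)
  qed
  \<comment> \<open>A slice that is reached through small states only is quiet: its weighted energy is zero, and near the
    background the energy density vanishes only in the background state.\<close>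
  have step: "quiet t" if t: "t \<in> {0..T}" and sm: "\<And>t'. t' \<in> {0..t} \<Longrightarrow> small t'" for t
  proof -
    have "E t \<le> E 0"
    proof (rule nonincreasing_if_derivative_nonpos[where f = E])
      fix t' assume t': "t' \<in> {0..t}"
      show "(E has_real_derivative (LINT x|lborel. D t' x)) (at t' within {0..t})"
        by (rule DERIV_subset[OF dE]) (use t t' in auto)
      show "(LINT x|lborel. D t' x) \<le> 0"
        using Bochner_Integration.integral_nonneg[of lborel "\<lambda>x. - D t' x"] D_nonpos[of t'] sm[of t'] t t'
        by simp
    qed (use t in auto)
    also have "\<theta> 0 x * energy 0 x = 0" for x
    proof (cases "norm (x - x0) < rad 0")
      case True then show ?thesis using quiet_0 energy_0 by (simp add: quiet_def)
    next
      case False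
      then have "\<psi> 0 x \<le> 0" using \<psi>_pos[of 0 x] T_pos by auto
      then show ?thesis by (simp add: \<theta>_def)
    qed
    then have "E 0 = 0" unfolding E_def by (simp only: integral_zero)
    finally have Et: "(LINT x|lborel. \<theta> t x * energy t x) \<le> 0" by (simp add: E_def)
    have nn: "\<theta> t x * energy t x \<ge> 0 \<and> (\<theta> t x * energy t x = 0 \<longrightarrow> norm (x - x0) < rad t \<longrightarrow> N t x = 0)" for x
    proof (cases "norm (x - x0) < rad t")
      case True
      then have "N t x < \<epsilon>" using sm[of t] t by (simp add: small_def)
      then have "r t x > 0" using \<eta>(2)[of "r t x"] norm_ge_zero[of "velocity t x"]
        unfolding N_def \<epsilon>_def by linarith
      then have \<Phi>: "\<Phi> (r t x) \<ge> 0" "\<Phi> (r t x) = 0 \<Longrightarrow> r t x = \<rho>bar"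
        using \<Phi>_pos[of "r t x"] \<Phi>_\<rho>bar by (cases "r t x = \<rho>bar"; force)+
      have k: "r t x * speed2 t x / 2 \<ge> 0" using \<open>r t x > 0\<close> speed2_nonneg by simp
      have "\<theta> t x > 0" using True \<psi>_pos[OF t, of x] by (simp add: \<theta>_def)
      moreover have "energy t x \<ge> 0" using k \<Phi> by (simp add: energy_def)
      moreover have "N t x = 0" if "energy t x = 0"
      proof -
        have "r t x * speed2 t x / 2 = 0" "\<Phi> (r t x) = 0"
          using that k \<Phi>(1) unfolding energy_def by linarith+
        then show ?thesis using \<Phi>(2) \<open>r t x > 0\<close> norm_velocity[of t x] by (simp add: N_def)
      qed
      ultimately show ?thesis by simp
    next
      case False
      then have "\<psi> t x \<le> 0" using \<psi>_pos[OF t, of x] by linarith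
      then show ?thesis using False by (simp add: \<theta>_def)
    qed
    have "\<theta> t x * energy t x = 0" for x
      by (rule nonneg_continuous_integral_nonpos_imp_0[OF continuous_on_slice[OF C1_continuous(1)[OF C1_mult[OF \<theta>_C1 e]] t]])
        (use \<theta>_0[OF t] nn Et in auto)
    then show ?thesis using nn by (simp add: quiet_def)
  qed
  have "uniformly_continuous_on ({0..T} \<times> cball x0 a) (\<lambda>z. N (fst z) (snd z))"
  proof (rule compact_uniformly_continuous)
    have sub: "{0..T} \<times> cball x0 a \<subseteq> {0..T} \<times> UNIV" by auto
    show "continuous_on ({0..T} \<times> cball x0 a) (\<lambda>z. N (fst z) (snd z))"
      unfolding N_def velocity_def
      by (intro continuous_intros continuous_on_vec_lambda
          continuous_on_subset[OF C1_continuous(1)[OF r_C1] sub] continuous_on_subset[OF C1_continuous(1)[OF v_C1] sub])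
  qed (auto intro: compact_Times)
  moreover have "\<epsilon> > 0" using \<eta>(1) s by (simp add: \<epsilon>_def)
  ultimately have "\<exists>d>0. \<forall>z\<in>{0..T} \<times> cball x0 a. \<forall>z'\<in>{0..T} \<times> cball x0 a. dist z' z < d \<longrightarrow>
      dist (N (fst z') (snd z')) (N (fst z) (snd z)) < \<epsilon>"
    unfolding uniformly_continuous_on_def by simp
  then obtain d where d: "d > 0" and unif: "\<forall>z\<in>{0..T} \<times> cball x0 a. \<forall>z'\<in>{0..T} \<times> cball x0 a. dist z' z < d \<longrightarrow>
      dist (N (fst z') (snd z')) (N (fst z) (snd z)) < \<epsilon>"
    by (elim exE conjE)
  \<comment> \<open>\<open>d / 2\<close> rather than \<open>d\<close>, because a step may have the full length while \<open>d\<close> bounds the distance strictly.\<close>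
  have all: "\<forall>t\<in>{0..T}. t \<le> of_nat n * (d / 2) \<longrightarrow> quiet t" for n :: nat
  proof (induction n)
    case 0
    have "t = 0" if "t \<in> {0..T}" "t \<le> of_nat 0 * (d / 2)" for t
      using that by simp
    then show ?case using quiet_0 by blast
  next
    case (Suc n)
    show ?case
    proof (intro ballI impI step)
      fix t t' assume t: "t \<in> {0..T}" "t \<le> of_nat (Suc n) * (d / 2)" and t': "t' \<in> {0..t}"
      \<comment> \<open>The time from which to step: at \<open>u\<close> the slice of the cone contains that at \<open>t'\<close> and is already quiet.\<close>
      define u where "u = min t' (of_nat n * (d / 2))"
      have u: "u \<in> {0..T}" "u \<le> t'" "t' - u \<le> d / 2" "u \<le> of_nat n * (d / 2)"
        using t t' d by (auto simp: u_def min_def algebra_simps)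
      then have "quiet u" using Suc by blast
      show "small t'"
        unfolding small_def
      proof (intro allI impI)
        fix x assume x: "norm (x - x0) < rad t'"
        then have "N u x = 0" using \<open>quiet u\<close> rad_le[OF u(2)] by (auto simp: quiet_def)
        moreover have "rad t' \<le> a" using rad_le[of 0 t'] t' by (simp add: rad_def)
        then have "x \<in> cball x0 a" using x by (simp add: dist_norm norm_minus_commute)
        then have "dist (N t' x) (N u x) < \<epsilon>"
          using unif[rule_format, of "(u, x)" "(t', x)"] u t t' d by (auto simp: dist_Pair_Pair dist_real_def)
        ultimately show "N t' x < \<epsilon>" by (simp add: dist_real_def)
      qed
    qed
  qed
  obtain n :: nat where "T < of_nat n * (d / 2)"
    using ex_less_of_nat_mult[of "d / 2" T] d by auto
  then have "quiet T" using all[of n] T_pos by simp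
  then show ?thesis using rad_pos[of T] T_pos by (simp add: quiet_def N_0)
qed

text \<open>Any point with \<open>|x| > M + t\<close> is the tip of a cone of some slope \<open>s > 1\<close> starting outside the ball of radius
  \<open>M\<close>; a slope halfway between \<open>1\<close> and \<open>(|x| - M)/t\<close> will do.\<close>

lemma finite_propagation_speed:
  assumes init: "\<And>x. norm x > M \<Longrightarrow> r 0 x = \<rho>bar" "\<And>x i. norm x > M \<Longrightarrow> v i 0 x = 0"
    and t: "t \<in> {0..T}" and x: "norm x > M + t"
  shows "r t x = \<rho>bar" "v i t x = 0"
proof -
  have "r t x = \<rho>bar \<and> (\<forall>i. v i t x = 0)"
  proof (cases "t = 0")
    case True
    then show ?thesis using x init by simp
  next
    case False
    then have t0: "t > 0" using t by simp
    interpret past: damped_euler A \<gamma> \<rho>bar t b r v rt rx vt vx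
      by (rule restrict_time) (use t t0 in auto)
    have less: "t * (M + t) < t * norm x" using x t0 by simp
    show ?thesis
      using t0 x by (intro past.constant_state_at_tip_of_cone[where M = M and s = "(1 + (norm x - M) / t) / 2"])
        (use less in \<open>auto simp: init field_simps\<close>)
  qed
  then show "r t x = \<rho>bar" "v i t x = 0" by auto
qed

end

section \<open>Nonnegativity of the density\<close>

locale damped_euler_front = damped_euler A \<gamma> \<rho>bar T b r v rt rx vt vx
  for A \<gamma> \<rho>bar T b r v rt rx vt vx +
  fixes M :: real
  assumes M_pos: "M > 0"
    and initial_r: "norm x > M \<Longrightarrow> r 0 x = \<rho>bar"
    and initial_v: "norm x > M \<Longrightarrow> v i 0 x = 0"
    and initial_pos: "r 0 x > 0"
begin

lemma outside: "t \<in> {0..T} \<Longrightarrow> norm x > M + t \<Longrightarrow> r t x = \<rho>bar"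
  "t \<in> {0..T} \<Longrightarrow> norm x > M + t \<Longrightarrow> v i t x = 0"
  using finite_propagation_speed[OF initial_r initial_v] by auto

text \<open>For \<open>n = (min \<rho> 0)\<^sup>2\<close> the continuity equation gives \<open>\<partial>\<^sub>tn + div (n u) = - n div u\<close>. As \<open>n\<close> has compact support,
  its integral satisfies a linear differential inequality and stays zero.\<close>

lemma density_nonneg:
  assumes t: "t \<in> {0..T}"
  shows "r t x \<ge> 0"
proof -
  let ?R = "M + T"
  let ?n = "\<lambda>t x. (min (r t x) 0)^2"
  have out: "?n t x = 0" if "t \<in> {0..T}" "norm x > ?R" for t x
    using outside(1)[OF that(1), of x] that \<rho>bar_pos by simp
  have c: "continuous_on UNIV (\<lambda>y::real. 2 * min y 0)" by (intro continuous_intros)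
  note n_C1 = C1_compose[OF r_C1 DERIV_square_min_0 c]
  have nv: "has_C1_partials T (\<lambda>t x. ?n t x * v j t x)
      (\<lambda>t x. 2 * min (r t x) 0 * rt t x * v j t x + ?n t x * vt j t x)
      (\<lambda>k t x. 2 * min (r t x) 0 * rx k t x * v j t x + ?n t x * vx j k t x)" for j
    by (rule C1_mult[OF n_C1 v_C1])
  have "continuous_on ({0..T} \<times> cball 0 ?R) (\<lambda>z. \<Sum>j\<in>UNIV. vx j j (fst z) (snd z))"
    by (intro continuous_intros continuous_on_subset[OF C1_continuous(3)[OF v_C1]]) auto
  then have "compact ((\<lambda>z. \<Sum>j\<in>UNIV. vx j j (fst z) (snd z)) ` ({0..T} \<times> cball 0 ?R))"
    by (rule compact_continuous_image) (auto intro: compact_Times)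
  then have "bounded ((\<lambda>z. \<Sum>j\<in>UNIV. vx j j (fst z) (snd z)) ` ({0..T} \<times> cball 0 ?R))"
    by (rule compact_imp_bounded)
  then obtain C where C': "\<forall>y \<in> (\<lambda>z. \<Sum>j\<in>UNIV. vx j j (fst z) (snd z)) ` ({0..T} \<times> cball 0 ?R). norm y \<le> C"
    unfolding bounded_iff by blast
  have C: "\<bar>\<Sum>j\<in>UNIV. vx j j t x\<bar> \<le> C" if "t \<in> {0..T}" "norm x \<le> ?R" for t x
    using bspec[OF C', OF image_eqI[of _ _ "(t, x)"]] that by simp
  define D where "D t x = 2 * min (r t x) 0 * rt t x
      + (\<Sum>j\<in>UNIV. 2 * min (r t x) 0 * rx j t x * v j t x + ?n t x * vx j j t x)" for t x
  define E where "E t = (LINT x|lborel. ?n t x)" for t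
  have dE: "(E has_real_derivative (LINT x|lborel. D t x)) (at t within {0..T})"
    and iD: "integrable lborel (D t)" if "t \<in> {0..T}" for t
    unfolding E_def[abs_def] D_def
    by (rule balance_law[OF T_pos n_C1 nv, where R = ?R];
      use out that in auto)+
  have n_int: "integrable lborel (?n t)" if "t \<in> {0..T}" for t
    by (rule integrable_compact_support[OF continuous_on_slice[OF C1_continuous(1)[OF n_C1] that]])
      (use out[OF that] in auto)
  have D_le: "D t x \<le> C * ?n t x" if t: "t \<in> {0..T}" for t x
  proof (cases "norm x > ?R")
    case True
    then show ?thesis using out[OF t, of x] by (simp add: D_def)
  next
    case False
    have "D t x = 2 * min (r t x) 0 * (rt t x + (\<Sum>j\<in>UNIV. rx j t x * v j t x + r t x * vx j j t x))
        + (?n t x - 2 * (min (r t x) 0 * r t x)) * (\<Sum>j\<in>UNIV. vx j j t x)"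
      unfolding D_def sum_3 by (simp add: algebra_simps)
    moreover have "min (r t x) 0 * r t x = ?n t x" by (simp add: min_def power2_eq_square)
    ultimately have "D t x = ?n t x * - (\<Sum>j\<in>UNIV. vx j j t x)"
      unfolding continuity[OF t] by simp
    also have "\<dots> \<le> ?n t x * C"
      by (rule mult_left_mono) (use C[OF t, of x] False in \<open>auto simp: abs_le_iff\<close>)
    finally show ?thesis by (simp add: mult.commute)
  qed
  have "exp (- C * t) * E t \<le> exp (- C * 0) * E 0"
  proof (rule nonincreasing_if_derivative_nonpos[where f = "\<lambda>s. exp (- C * s) * E s"])
    fix s assume s: "s \<in> {0..t}"
    then have s': "s \<in> {0..T}" using t by auto
    have "((\<lambda>s. exp (- C * s) * E s) has_real_derivative
        exp (- C * s) * ((LINT x|lborel. D s x) - C * E s)) (at s within {0..T})"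
      by (auto intro!: derivative_eq_intros dE[OF s'] simp: algebra_simps)
    then show "((\<lambda>s. exp (- C * s) * E s) has_real_derivative
        exp (- C * s) * ((LINT x|lborel. D s x) - C * E s)) (at s within {0..t})"
      by (rule DERIV_subset) (use t in auto)
    have "(LINT x|lborel. D s x) \<le> (LINT x|lborel. C * ?n s x)"
      by (rule integral_mono[OF iD[OF s'] _ D_le[OF s']]) (use n_int[OF s'] in simp)
    then show "exp (- C * s) * ((LINT x|lborel. D s x) - C * E s) \<le> 0"
      by (intro mult_nonneg_nonpos) (simp_all add: E_def)
  qed (use t in auto)
  also have "E 0 = 0"
    using initial_pos by (simp add: E_def min_absorb2 less_imp_le)
  finally have "(LINT x|lborel. ?n t x) \<le> 0" by (simp add: E_def mult_le_0_iff)
  moreover have "continuous_on UNIV (?n t)"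
    by (rule continuous_on_slice[OF C1_continuous(1)[OF n_C1] t])
  ultimately have "?n t x = 0"
    using nonneg_continuous_integral_nonpos_imp_0[of "?n t" ?R x] out[OF t] by simp
  then show ?thesis by (simp add: min_def split: if_splits)
qed

section \<open>Mass and radial momentum\<close>

definition excess_mass :: "real \<Rightarrow> real" where
  "excess_mass t = (LINT x|lborel. r t x - \<rho>bar)"

lemma excess_mass_C1: "has_C1_partials T (\<lambda>t x. r t x - \<rho>bar) rt rx"
  by (rule C1_rhs[OF C1_diff[OF r_C1 C1_const]]) auto

lemma integrable_excess:
  assumes t: "t \<in> {0..T}"
  shows "integrable lborel (\<lambda>x. r t x - \<rho>bar)"
  by (rule integrable_compact_support[OF continuous_on_slice[OF C1_continuous(1)[OF excess_mass_C1] t], where R = "M + t"])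
    (use outside(1)[OF t] in auto)

lemma excess_mass_constant:
  assumes t: "t \<in> {0..T}"
  shows "excess_mass t = excess_mass 0"
proof -
  have "(excess_mass has_real_derivative 0) (at s within {0..T})" if s: "s \<in> {0..T}" for s
  proof -
    have "(excess_mass has_real_derivative
        (LINT x|lborel. rt s x + (\<Sum>j\<in>UNIV. rx j s x * v j s x + r s x * vx j j s x))) (at s within {0..T})"
      unfolding excess_mass_def[abs_def]
      by (rule balance_law(1)[OF T_pos excess_mass_C1 C1_mult[OF r_C1 v_C1], where R = "M + T"])
        (use s outside in auto)
    then show ?thesis by (simp add: continuity[OF s])
  qed
  then obtain c where "\<And>s. s \<in> {0..T} \<Longrightarrow> excess_mass s = c"
    using has_field_derivative_zero_constant[of "{0..T}" excess_mass] by auto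
  then show ?thesis using t T_pos by simp
qed

definition radial_momentum :: "real \<Rightarrow> real^3 \<Rightarrow> real" where
  "radial_momentum t x = (\<Sum>i\<in>UNIV. x $ i * (r t x * v i t x))"

definition H :: "real \<Rightarrow> real" where
  "H t = (LINT x|lborel. radial_momentum t x)"

lemma rv_C1:
  "has_C1_partials T (\<lambda>t x. r t x * v i t x) (\<lambda>t x. rt t x * v i t x + r t x * vt i t x)
    (\<lambda>j t x. rx j t x * v i t x + r t x * vx i j t x)"
  by (rule C1_mult[OF r_C1 v_C1])

lemma radial_momentum_C1:
  "has_C1_partials T radial_momentum
    (\<lambda>t x. \<Sum>i\<in>UNIV. x $ i * (rt t x * v i t x + r t x * vt i t x))
    (\<lambda>j t x. \<Sum>i\<in>UNIV. (if i = j then 1 else 0) * (r t x * v i t x) + x $ i * (rx j t x * v i t x + r t x * vx i j t x))"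
  unfolding radial_momentum_def[abs_def]
  by (rule C1_rhs[OF C1_sum[OF C1_mult[OF C1_coordinate rv_C1]]]) auto

lemma integrable_radial_momentum:
  assumes t: "t \<in> {0..T}"
  shows "integrable lborel (radial_momentum t)"
  by (rule integrable_compact_support[OF continuous_on_slice[OF C1_continuous(1)[OF radial_momentum_C1] t], where R = "M + t"])
    (use outside(2)[OF t] in \<open>auto simp: radial_momentum_def\<close>)

text \<open>Virial identity: with the flux \<open>F\<^sub>j = (x \<bullet> \<rho>u) u\<^sub>j + x\<^sub>j (p(\<rho>) - p(\<rho>bar))\<close> the terms in which a derivative falls on
  \<open>x\<close> are \<open>\<rho> |u|\<^sup>2\<close> and \<open>3 (p(\<rho>) - p(\<rho>bar))\<close>, and all others add up to \<open>x\<close> times the momentum equation.\<close>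

lemma DERIV_H:
  assumes t: "t \<in> {0..T}"
  defines "D \<equiv> \<lambda>x. r t x * speed2 t x + 3 * (p (r t x) - p \<rho>bar) - b t * radial_momentum t x"
  shows "(H has_real_derivative (LINT x|lborel. D x)) (at t within {0..T})"
    and "integrable lborel D"
proof -
  let ?F = "\<lambda>j t x. radial_momentum t x * v j t x + x $ j * (p (r t x) - p \<rho>bar)"
  let ?Fx = "\<lambda>j k t x. (\<Sum>i\<in>UNIV. (if i = k then 1 else 0) * (r t x * v i t x) + x $ i * (rx k t x * v i t x + r t x * vx i k t x)) * v j t x
      + radial_momentum t x * vx j k t x + ((if j = k then 1 else 0) * (p (r t x) - p \<rho>bar) + x $ j * (p' (r t x) * rx k t x - 0))"
  note F_C1 = C1_add[OF C1_mult[OF radial_momentum_C1 v_C1]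
    C1_mult[OF C1_coordinate C1_diff[OF C1_compose[OF r_C1 DERIV_p continuous_p'] C1_const[of T "p \<rho>bar"]]]]
  let ?D = "\<lambda>x. (\<Sum>i\<in>UNIV. x $ i * (rt t x * v i t x + r t x * vt i t x)) + (\<Sum>j\<in>UNIV. ?Fx j j t x)"
  have out: "radial_momentum t x = 0" "?F j t x = 0" if "t \<in> {0..T}" "norm x > M + T" for t x j
    using outside[OF that(1), of x] that by (auto simp: radial_momentum_def)
  have D: "?D x = D x" for x
  proof -
    have "?D x = (\<Sum>i\<in>UNIV. x $ i * (rt t x * v i t x + r t x * vt i t x
      + (\<Sum>j\<in>UNIV. (rx j t x * v i t x + r t x * vx i j t x) * v j t x + r t x * v i t x * vx j j t x)
      + p' (r t x) * rx i t x)) + r t x * speed2 t x + 3 * (p (r t x) - p \<rho>bar)"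
      unfolding sum_3 speed2_def radial_momentum_def by (simp add: algebra_simps)
    also have "\<dots> = (\<Sum>i\<in>UNIV. x $ i * (- b t * (r t x * v i t x))) + r t x * speed2 t x + 3 * (p (r t x) - p \<rho>bar)"
      unfolding momentum[OF t] ..
    also have "\<dots> = D x"
      unfolding D_def radial_momentum_def sum_3 by (simp add: algebra_simps)
    finally show ?thesis .
  qed
  have 1: "((\<lambda>s. LINT x|lborel. radial_momentum s x) has_real_derivative (LINT x|lborel. ?D x)) (at t within {0..T})"
    by (rule balance_law(1)[OF T_pos radial_momentum_C1 F_C1, where R = "M + T"]) (use out t in auto)
  have 2: "integrable lborel ?D"
    by (rule balance_law(2)[OF T_pos radial_momentum_C1 F_C1, where R = "M + T"]) (use out t in auto)
  show "(H has_real_derivative (LINT x|lborel. D x)) (at t within {0..T})" "integrable lborel D"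
    using 1 2 unfolding D H_def[abs_def] by simp_all
qed

text \<open>Convexity of the pressure gives \<open>p(\<rho>) - p(\<rho>bar) \<ge> \<rho> - \<rho>bar\<close>, whose integral is the excess mass. For the kinetic
  term, the Cauchy--Schwarz inequality \<open>H\<^sup>2 \<le> (\<integral>\<rho>|u|\<^sup>2) (\<integral>\<rho>|x|\<^sup>2)\<close> is used in the form of \<open>0 \<le> \<integral>\<rho> |u - l x|\<^sup>2\<close> with
  \<open>l = H/\<alpha>\<close>; the second moment is bounded by \<open>(M + t)\<^sup>2\<close> times the mass in the ball of radius \<open>M + t\<close>, which
  is the excess mass plus the background mass.\<close>

lemma H_riccati:
  assumes t: "t \<in> {0..T}" and L0: "excess_mass 0 \<ge> 0"
    and \<alpha>: "\<alpha> > 0" "\<alpha> \<ge> (M + t)^2 * (excess_mass 0 + 4 / 3 * pi * \<rho>bar * (M + t)^3)"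
  shows "(LINT x|lborel. r t x * speed2 t x + 3 * (p (r t x) - p \<rho>bar) - b t * radial_momentum t x)
     \<ge> (H t)^2 / \<alpha> - b t * H t"
proof -
  let ?R = "M + t"
  \<comment> \<open>The multiple of \<open>x\<close> for which \<open>2 l H - l\<^sup>2 \<alpha>\<close> is largest.\<close>
  define l where "l = H t / \<alpha>"
  let ?D = "\<lambda>x. r t x * speed2 t x + 3 * (p (r t x) - p \<rho>bar) - b t * radial_momentum t x"
  let ?low = "\<lambda>x. (2 * l - b t) * radial_momentum t x + (3 - l^2 * ?R^2) * (r t x - \<rho>bar)
      - l^2 * ?R^2 * \<rho>bar * indicat_real (cball 0 ?R) x"
  have R: "?R > 0" using M_pos t by simp
  have le: "?low x \<le> ?D x" for x
  proof (cases "norm x > ?R")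
    case True
    then show ?thesis using outside[OF t] by (simp add: speed2_def radial_momentum_def)
  next
    case False
    have rm: "radial_momentum t x = r t x * (x \<bullet> velocity t x)"
      by (simp add: radial_momentum_def inner_vec_def velocity_def sum_distrib_left algebra_simps)
    have "0 \<le> r t x * (norm (velocity t x - l *\<^sub>R x))^2"
      using density_nonneg[OF t] by simp
    also have "(norm (velocity t x - l *\<^sub>R x))^2 = speed2 t x - 2 * l * (x \<bullet> velocity t x) + l^2 * (norm x)^2"
      unfolding norm_velocity[symmetric] power2_norm_eq_inner
      by (simp add: inner_diff_left inner_diff_right inner_commute power2_eq_square)
    finally have "r t x * speed2 t x \<ge> 2 * l * radial_momentum t x - l^2 * (r t x * (norm x)^2)"
      by (simp add: rm algebra_simps)
    moreover have "l^2 * (r t x * (norm x)^2) \<le> l^2 * (r t x * ?R^2)"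
      using False density_nonneg[OF t] by (intro mult_left_mono power_mono) auto
    moreover have "p (r t x) - p \<rho>bar \<ge> r t x - \<rho>bar"
      by (rule p_above_tangent[OF density_nonneg[OF t]])
    moreover have "y - c' + 3 * z \<le> s + 3 * z'" if "y - c \<le> s" "c \<le> c'" "z \<le> z'" for y c c' s z z' :: real
      using that by linarith
    ultimately have "2 * l * radial_momentum t x - l^2 * (r t x * ?R^2) + 3 * (r t x - \<rho>bar)
        \<le> r t x * speed2 t x + 3 * (p (r t x) - p \<rho>bar)" by blast
    moreover have "indicat_real (cball 0 ?R) x = 1" using False by simp
    ultimately show ?thesis by (simp add: algebra_simps)
  qed
  have fin: "integrable lborel (indicat_real (cball (0::real^3) ?R))"
    by (rule integrable_real_indicator) (auto simp: emeasure_cball R less_imp_le)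
  have vol: "(LINT x|lborel. indicat_real (cball (0::real^3) ?R) x) = 4 / 3 * pi * ?R^3"
    using emeasure_cball[of ?R "0 :: real^3"] R by (simp add: measure_def unit_ball_vol_3)
  note ints = integrable_radial_momentum[OF t] integrable_excess[OF t] fin
  have "(LINT x|lborel. ?low x) \<le> (LINT x|lborel. ?D x)"
    by (rule integral_mono[OF _ DERIV_H(2)[OF t] le]) (use ints in auto)
  also have "(LINT x|lborel. ?low x) = (2 * l - b t) * H t + (3 - l^2 * ?R^2) * excess_mass 0
      - l^2 * ?R^2 * \<rho>bar * (4 / 3 * pi * ?R^3)"
    unfolding vol[symmetric] excess_mass_constant[OF t, symmetric]
    using ints by (simp add: H_def excess_mass_def del: integral_indicator)
  also have "\<dots> = 2 * l * H t - b t * H t + 3 * excess_mass 0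
      - l^2 * (?R^2 * (excess_mass 0 + 4 / 3 * pi * \<rho>bar * ?R^3))"
    by (simp add: algebra_simps)
  finally have 1: "2 * l * H t - b t * H t + 3 * excess_mass 0
      - l^2 * (?R^2 * (excess_mass 0 + 4 / 3 * pi * \<rho>bar * ?R^3)) \<le> (LINT x|lborel. ?D x)" .
  have "l^2 * (?R^2 * (excess_mass 0 + 4 / 3 * pi * \<rho>bar * ?R^3)) \<le> l^2 * \<alpha>"
    using \<alpha>(2) by (intro mult_left_mono) auto
  also have "l^2 * \<alpha> = (H t)^2 / \<alpha>" using \<alpha>(1) by (simp add: l_def power2_eq_square)
  finally have "l^2 * (?R^2 * (excess_mass 0 + 4 / 3 * pi * \<rho>bar * ?R^3)) \<le> (H t)^2 / \<alpha>" .
  moreover have "2 * l * H t = 2 * ((H t)^2 / \<alpha>)" by (simp add: l_def power2_eq_square)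
  ultimately show ?thesis using 1 L0 by linarith
qed

end

section \<open>Blow-up of the Riccati inequality\<close>

text \<open>\<open>\<beta>\<close> is the integrating factor of the damping: \<open>G = \<beta> H\<close> satisfies \<open>G' \<ge> G\<^sup>2/(\<alpha>\<beta>)\<close>. Hence \<open>G\<close> stays positive and
  \<open>1/G + \<integral>1/(\<alpha>\<beta>)\<close> is nonincreasing; it equals \<open>1/H 0\<close> at the beginning.\<close>

lemma riccati_blowup:
  fixes H H' b \<alpha> \<beta> :: "real \<Rightarrow> real"
  assumes T: "0 < T" "T \<le> T1"
    and H: "\<And>t. t \<in> {0..T1} \<Longrightarrow> (H has_real_derivative H' t) (at t within {0..T1})"
    and H': "\<And>t. t \<in> {0..T1} \<Longrightarrow> H' t \<ge> (H t)^2 / \<alpha> t - b t * H t"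
    and \<beta>: "\<And>t. t \<in> {0..T1} \<Longrightarrow> (\<beta> has_real_derivative b t * \<beta> t) (at t within {0..T1})"
    and pos: "\<And>t. t \<in> {0..T1} \<Longrightarrow> \<alpha> t > 0" "\<And>t. t \<in> {0..T1} \<Longrightarrow> \<beta> t > 0" "\<beta> 0 = 1"
    and \<alpha>: "continuous_on {0..T1} \<alpha>"
    and H0: "H 0 > 0"
  shows "H 0 * integral {0..T} (\<lambda>t. 1 / (\<alpha> t * \<beta> t)) < 1"
proof -
  define G where "G t = \<beta> t * H t" for t
  define J where "J t = integral {0..t} (\<lambda>t. 1 / (\<alpha> t * \<beta> t))" for t
  have sub: "t \<in> {0..T1}" if "t \<in> {0..T}" for t using that T by auto
  have c: "continuous_on {0..T1} (\<lambda>t. 1 / (\<alpha> t * \<beta> t))"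
  proof -
    have "continuous_on {0..T1} \<beta>" by (rule DERIV_continuous_on[OF \<beta>])
    moreover have "\<alpha> t * \<beta> t \<noteq> 0" if "t \<in> {0..T1}" for t
      using pos(1)[OF that] pos(2)[OF that] by simp
    ultimately show ?thesis using \<alpha> by (intro continuous_on_divide continuous_on_mult continuous_on_const) auto
  qed
  have dG: "(G has_real_derivative \<beta> t * (H' t + b t * H t)) (at t within {0..T1})" if "t \<in> {0..T1}" for t
    unfolding G_def[abs_def] using DERIV_mult[OF \<beta>[OF that] H[OF that]] by (simp add: algebra_simps)
  have G': "\<beta> t * (H' t + b t * H t) \<ge> (G t)^2 * (1 / (\<alpha> t * \<beta> t))" if t: "t \<in> {0..T1}" for t
  proof -
    have "\<beta> t * ((H t)^2 / \<alpha> t) \<le> \<beta> t * (H' t + b t * H t)"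
      using H'[OF t] pos(2)[OF t] by (intro mult_left_mono) auto
    also have "\<beta> t * ((H t)^2 / \<alpha> t) = (G t)^2 * (1 / (\<alpha> t * \<beta> t))"
      using pos(1,2)[OF t] by (simp add: G_def power2_eq_square)
    finally show ?thesis .
  qed
  have G_pos: "G t > 0" if t: "t \<in> {0..T1}" for t
  proof -
    have "- G t \<le> - G 0"
    proof (rule nonincreasing_if_derivative_nonpos[where f = "\<lambda>t. - G t"])
      fix s assume s: "s \<in> {0..t}"
      then have s': "s \<in> {0..T1}" using t by auto
      show "((\<lambda>t. - G t) has_real_derivative - (\<beta> s * (H' s + b s * H s))) (at s within {0..t})"
        by (rule DERIV_subset[OF DERIV_minus[OF dG[OF s']]]) (use t in auto)
      have "0 \<le> (G s)^2 * (1 / (\<alpha> s * \<beta> s))" using pos(1,2)[OF s'] by simp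
      then show "- (\<beta> s * (H' s + b s * H s)) \<le> 0" using G'[OF s'] by linarith
    qed (use t in auto)
    moreover have "G 0 > 0" using H0 pos(3) by (simp add: G_def)
    ultimately show ?thesis by simp
  qed
  have "1 / G T + J T \<le> 1 / G 0 + J 0"
  proof (rule nonincreasing_if_derivative_nonpos[where f = "\<lambda>t. 1 / G t + J t"])
    fix t assume t: "t \<in> {0..T}"
    have "((\<lambda>t. inverse (G t) + J t) has_real_derivative
        - (inverse (G t) * (\<beta> t * (H' t + b t * H t)) * inverse (G t)) + 1 / (\<alpha> t * \<beta> t)) (at t within {0..T1})"
      unfolding J_def[abs_def] using G_pos[OF sub[OF t]]
      by (intro DERIV_add DERIV_inverse' dG integral_has_real_derivative[OF c] sub[OF t]) simp
    then show "((\<lambda>t. 1 / G t + J t) has_real_derivative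
        - (inverse (G t) * (\<beta> t * (H' t + b t * H t)) * inverse (G t)) + 1 / (\<alpha> t * \<beta> t)) (at t within {0..T})"
      unfolding inverse_eq_divide by (rule DERIV_subset) (use T in auto)
    have "inverse (G t) * ((G t)^2 * (1 / (\<alpha> t * \<beta> t))) * inverse (G t)
        \<le> inverse (G t) * (\<beta> t * (H' t + b t * H t)) * inverse (G t)"
      using G'[OF sub[OF t]] G_pos[OF sub[OF t]] by (intro mult_left_mono mult_right_mono) auto
    moreover have "inverse (G t) * ((G t)^2 * (1 / (\<alpha> t * \<beta> t))) * inverse (G t) = 1 / (\<alpha> t * \<beta> t)"
    proof -
      have "inverse g * (g^2 * y) * inverse g = y" if "g > 0" for g y :: real
        using that by (simp add: field_simps power2_eq_square)
      then show ?thesis using G_pos[OF sub[OF t]] by blast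
    qed
    ultimately show "- (inverse (G t) * (\<beta> t * (H' t + b t * H t)) * inverse (G t)) + 1 / (\<alpha> t * \<beta> t) \<le> 0"
      by linarith
  qed (use T in auto)
  moreover have "1 / G T > 0" using G_pos[of T] T by simp
  moreover have "1 / G 0 = 1 / H 0" "J 0 = 0" using pos(3) by (simp_all add: G_def J_def)
  ultimately have "J T < 1 / H 0" by linarith
  then show ?thesis using H0 by (simp add: J_def pos_less_divide_eq mult.commute)
qed

section \<open>Solutions of the Cauchy problem\<close>

lemma C1_on_imp_has_C1_partials:
  fixes f :: "real \<Rightarrow> real^3 \<Rightarrow> 'b::real_normed_vector"
  assumes f: "C1_on (\<lambda>(t, x). f t x) ({0..T} \<times> UNIV)" and L: "bounded_linear L"
  obtains ft fx where "has_C1_partials T (\<lambda>t x. L (f t x)) ft fx"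
proof -
  let ?S = "{0..T} \<times> (UNIV :: (real^3) set)"
  from f obtain f' where f': "\<And>z. z \<in> ?S \<Longrightarrow> ((\<lambda>(t, x). f t x) has_derivative blinfun_apply (f' z)) (at z within ?S)"
    and c: "continuous_on ?S f'"
    unfolding C1_on_def by blast
  define g where "g z = L (f (fst z) (snd z))" for z
  have g': "(g has_derivative (\<lambda>h. L (blinfun_apply (f' z) h))) (at z within ?S)" if "z \<in> ?S" for z
    using bounded_linear.has_derivative[OF L f'[OF that]] by (simp add: g_def[abs_def] split_beta)
  have cL: "continuous_on ?S (\<lambda>z. L (blinfun_apply (f' z) h))" for h
    by (intro bounded_linear.continuous_on[OF L] continuous_intros c)
  have "has_C1_partials T (\<lambda>t x. L (f t x)) (\<lambda>t x. L (blinfun_apply (f' (t, x)) (1, 0)))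
      (\<lambda>j t x. L (blinfun_apply (f' (t, x)) (0, axis j 1)))"
    unfolding has_C1_partials_def
  proof (intro conjI allI ballI)
    show "continuous_on ?S (\<lambda>z. L (f (fst z) (snd z)))"
      using has_derivative_continuous_on[OF g'] by (simp add: g_def[abs_def])
  next
    fix t x j assume t: "t \<in> {0..T}"
    have lin: "L (blinfun_apply (f' (t, x)) (h *\<^sub>R w)) = h * L (blinfun_apply (f' (t, x)) w)"
      if "\<And>y c. L (c *\<^sub>R y) = c * L y" for h w
      using that by (simp add: blinfun.scaleR_right)
    have Ls: "L (c *\<^sub>R y) = c * L y" for c y
      using bounded_linear.linear[OF L] by (simp add: linear_scale)
    have "((\<lambda>s. g (s, x)) has_derivative (\<lambda>h. L (blinfun_apply (f' (t, x)) (h, 0)))) (at t within {0..T})"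
    proof (rule has_derivative_in_compose2[where g = g and f = "\<lambda>s. (s, x)" and t = ?S
          and g' = "\<lambda>z h. L (blinfun_apply (f' z) h)" and f' = "\<lambda>h. (h, 0)"])
      show "(g has_derivative (\<lambda>h. L (blinfun_apply (f' z) h))) (at z within ?S)" if "z \<in> ?S" for z
        by (rule g'[OF that])
      show "((\<lambda>s. (s, x)) has_derivative (\<lambda>h. (h, 0))) (at t within {0..T})"
        by (rule has_derivative_Pair[OF has_derivative_ident has_derivative_const])
    qed (use t in auto)
    moreover have "(\<lambda>h. L (blinfun_apply (f' (t, x)) (h, 0))) = (*) (L (blinfun_apply (f' (t, x)) (1, 0)))"
    proof (rule ext)
      show "L (blinfun_apply (f' (t, x)) (h, 0)) = L (blinfun_apply (f' (t, x)) (1, 0)) * h" for h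
        using lin[OF Ls, of h "(1, 0)"] by (simp add: mult.commute)
    qed
    ultimately show "((\<lambda>s. L (f s x)) has_real_derivative L (blinfun_apply (f' (t, x)) (1, 0))) (at t within {0..T})"
      by (simp add: has_field_derivative_def g_def)
    have "((\<lambda>h. g (t, x + h *\<^sub>R axis j 1)) has_derivative
        (\<lambda>h. L (blinfun_apply (f' (t, x + 0 *\<^sub>R axis j 1)) (0, h *\<^sub>R axis j 1)))) (at 0 within UNIV)"
    proof (rule has_derivative_in_compose2[where g = g and f = "\<lambda>h. (t, x + h *\<^sub>R axis j 1)" and t = ?S
          and g' = "\<lambda>z h. L (blinfun_apply (f' z) h)" and f' = "\<lambda>h. (0, h *\<^sub>R axis j 1)"])
      show "(g has_derivative (\<lambda>h. L (blinfun_apply (f' z) h))) (at z within ?S)" if "z \<in> ?S" for z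
        by (rule g'[OF that])
      have "((\<lambda>h. x + h *\<^sub>R axis j 1) has_derivative (\<lambda>h. 0 + h *\<^sub>R axis j 1)) (at 0 within UNIV)"
        by (intro has_derivative_add has_derivative_const has_derivative_scaleR_left has_derivative_ident)
      then show "((\<lambda>h. (t, x + h *\<^sub>R axis j 1)) has_derivative (\<lambda>h. (0, h *\<^sub>R axis j 1))) (at 0 within UNIV)"
        using has_derivative_Pair[OF has_derivative_const] by simp
    qed (use t in auto)
    moreover have "(\<lambda>h. L (blinfun_apply (f' (t, x + 0 *\<^sub>R axis j 1)) (0, h *\<^sub>R axis j 1)))
        = (*) (L (blinfun_apply (f' (t, x)) (0, axis j 1)))"
    proof (rule ext)
      show "L (blinfun_apply (f' (t, x + 0 *\<^sub>R axis j 1)) (0, h *\<^sub>R axis j 1))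
          = L (blinfun_apply (f' (t, x)) (0, axis j 1)) * h" for h
        using lin[OF Ls, of h "(0, axis j 1)"] by (simp add: mult.commute)
    qed
    ultimately show "((\<lambda>h. L (f t (x + h *\<^sub>R axis j 1))) has_real_derivative
        L (blinfun_apply (f' (t, x)) (0, axis j 1))) (at 0)"
      by (simp add: has_field_derivative_def g_def)
  qed (simp_all add: cL)
  then show thesis by (rule that)
qed

lemma dt_eq:
  assumes T: "T > 0" and f: "has_C1_partials T f ft fx" and t: "t \<in> {0..T}"
  shows "dt T f t x = ft t x"
  unfolding dt_def using vector_derivative_within_closed_interval[OF T t] C1_time_derivative[OF f t, of x]
  by (simp add: has_real_derivative_iff_has_vector_derivative)

lemma dt_vec_eq:
  assumes T: "T > 0" and f: "\<And>i. has_C1_partials T (\<lambda>t x. f t x $ i) (ft i) (fx i)" and t: "t \<in> {0..T}"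
  shows "dt T f t x $ i = ft i t x"
proof -
  have "((\<lambda>s. \<chi> i. f s x $ i) has_vector_derivative (\<chi> i. ft i t x)) (at t within {0..T})"
    unfolding has_vector_derivative_def
    using C1_time_derivative[OF f t]
    by (subst has_derivative_componentwise_within)
      (auto simp: Basis_vec_def inner_axis' inner_axis has_real_derivative_iff_has_vector_derivative
        has_vector_derivative_def)
  then have d: "((\<lambda>s. f s x) has_vector_derivative (\<chi> i. ft i t x)) (at t within {0..T})" by simp
  then show ?thesis
    unfolding dt_def using vector_derivative_within_closed_interval[OF T t d] by simp
qed

text \<open>The vector form of the equations, with derivatives taken by \<^const>\<open>dt\<close> and \<^const>\<open>pd\<close>, is expanded by the
  product rule into the scalar form on which the energy method operates.\<close>

lemma damped_euler_of_solution:
  assumes gas: "normalized_gas A \<gamma> \<rho>bar" and \<mu>: "\<mu> > 0" and T: "T > 0"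
    and sol: "damped_euler_solution A \<gamma> \<rho>bar \<mu> lam \<rho>0 u0 T \<rho> u"
  obtains rt rx vt vx where
    "damped_euler A \<gamma> \<rho>bar T (\<lambda>t. \<mu> / (1 + t) powr lam) \<rho> (\<lambda>i t x. u t x $ i) rt rx vt vx"
proof -
  interpret normalized_gas A \<gamma> \<rho>bar by (rule gas)
  have \<rho>C1: "C1_on (\<lambda>(t, x). \<rho> t x) ({0..T} \<times> UNIV)" and uC1: "C1_on (\<lambda>(t, x). u t x) ({0..T} \<times> UNIV)"
    and mass: "\<And>t x. t \<in> {0..T} \<Longrightarrow> dt T \<rho> t x + div_vec (\<lambda>y. \<rho> t y *\<^sub>R u t y) x = 0"
    and mom: "\<And>t x. t \<in> {0..T} \<Longrightarrow> dt T (\<lambda>s y. \<rho> s y *\<^sub>R u s y) t x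
          + div_mat (\<lambda>y. \<rho> t y *\<^sub>R outer (u t y) (u t y) + p (\<rho> t y) *\<^sub>R mat 1) x
        = - (\<mu> / (1 + t) powr lam) *\<^sub>R (\<rho> t x *\<^sub>R u t x)"
    using sol unfolding damped_euler_solution_def by blast+
  obtain rt rx where r: "has_C1_partials T \<rho> rt rx"
    using C1_on_imp_has_C1_partials[OF \<rho>C1 bounded_linear_ident] by auto
  have "\<forall>i. \<exists>ft fx. has_C1_partials T (\<lambda>t x. u t x $ i) ft fx"
    using C1_on_imp_has_C1_partials[OF uC1 bounded_linear_vec_nth] by metis
  then obtain vt vx where v: "\<And>i. has_C1_partials T (\<lambda>t x. u t x $ i) (vt i) (vx i)"
    by metis
  have rv: "has_C1_partials T (\<lambda>t x. \<rho> t x * u t x $ i) (\<lambda>t x. rt t x * u t x $ i + \<rho> t x * vt i t x)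
      (\<lambda>j t x. rx j t x * u t x $ i + \<rho> t x * vx i j t x)" for i
    by (rule C1_mult[OF r v])
  show thesis
  proof (rule that, unfold_locales)
    show "T > 0" by (rule T)
    show "has_C1_partials T \<rho> rt rx" by (rule r)
    show "has_C1_partials T (\<lambda>t x. u t x $ i) (vt i) (vx i)" for i by (rule v)
    show "\<mu> / (1 + t) powr lam \<ge> 0" for t using \<mu> by simp
  next
    fix t x assume t: "t \<in> {0..T}"
    show "rt t x + (\<Sum>j\<in>UNIV. rx j t x * u t x $ j + \<rho> t x * vx j j t x) = 0"
      using mass[OF t, of x] C1_pd[OF rv t] by (simp add: dt_eq[OF T r t] div_vec_def)
  next
    fix t x i assume t: "t \<in> {0..T}"
    let ?\<delta> = "\<lambda>i j :: 3. if i = j then 1 else (0::real)"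
    have flux: "pd j (\<lambda>y. (\<rho> t y *\<^sub>R outer (u t y) (u t y) + p (\<rho> t y) *\<^sub>R mat 1) $ i $ j) x
      = (rx j t x * u t x $ i + \<rho> t x * vx i j t x) * u t x $ j + \<rho> t x * u t x $ i * vx j j t x
        + p' (\<rho> t x) * rx j t x * ?\<delta> i j" for j
      using C1_pd[OF C1_add[OF C1_mult[OF rv v] C1_mult[OF C1_compose[OF r DERIV_p continuous_p'] C1_const]] t, of j i j "?\<delta> i j" x]
      by (simp add: outer_def mat_def mult.assoc)
    have "dt T (\<lambda>s y. \<rho> s y *\<^sub>R u s y) t x $ i = rt t x * u t x $ i + \<rho> t x * vt i t x"
      by (rule dt_vec_eq[OF T _ t]) (use rv in simp)
    moreover have "(\<Sum>j\<in>UNIV. p' (\<rho> t x) * rx j t x * ?\<delta> i j) = p' (\<rho> t x) * rx i t x"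
      by (simp add: if_distrib[of "\<lambda>y. _ * y"] cong: if_cong)
    moreover have "dt T (\<lambda>s y. \<rho> s y *\<^sub>R u s y) t x $ i
        + (\<Sum>j\<in>UNIV. pd j (\<lambda>y. (\<rho> t y *\<^sub>R outer (u t y) (u t y) + p (\<rho> t y) *\<^sub>R mat 1) $ i $ j) x)
      = - (\<mu> / (1 + t) powr lam) * (\<rho> t x * u t x $ i)"
      using arg_cong[OF mom[OF t, of x], of "\<lambda>w. w $ i"] by (simp add: div_mat_def)
    ultimately show "rt t x * u t x $ i + \<rho> t x * vt i t x
      + (\<Sum>j\<in>UNIV. (rx j t x * u t x $ i + \<rho> t x * vx i j t x) * u t x $ j + \<rho> t x * u t x $ i * vx j j t x)
      + p' (\<rho> t x) * rx i t x = - (\<mu> / (1 + t) powr lam) * (\<rho> t x * u t x $ i)"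
      unfolding flux sum.distrib by simp
  qed
qed

lemma DERIV_beta_fun:
  assumes "t \<ge> 0"
  shows "(beta_fun \<mu> lam has_real_derivative \<mu> / (1 + t) powr lam * beta_fun \<mu> lam t) (at t within S)"
proof -
  have "(beta_fun \<mu> lam has_real_derivative \<mu> / (1 + t) powr lam * beta_fun \<mu> lam t) (at t)"
  proof (cases "lam = 1")
    case True
    then have b: "beta_fun \<mu> lam = (\<lambda>t. (1 + t) powr \<mu>)" by (simp add: beta_fun_def fun_eq_iff)
    have "((\<lambda>t. (1 + t) powr \<mu>) has_real_derivative \<mu> * (1 + t) powr (\<mu> - 1)) (at t)"
      using assms by (auto intro!: derivative_eq_intros)
    then show ?thesis using assms True unfolding b by (simp add: powr_diff)
  next
    case False
    then have b: "beta_fun \<mu> lam = (\<lambda>t. exp (\<mu> / (1 - lam) * ((1 + t) powr (1 - lam) - 1)))"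
      by (simp add: beta_fun_def fun_eq_iff)
    have "((\<lambda>t. (1 + t) powr (1 - lam)) has_real_derivative (1 - lam) * (1 + t) powr (- lam)) (at t)"
      using assms by (auto intro!: derivative_eq_intros)
    from DERIV_fun_exp[OF DERIV_cmult[OF DERIV_diff[OF this DERIV_const[of 1]], of "\<mu> / (1 - lam)"]]
    have "((\<lambda>t. exp (\<mu> / (1 - lam) * ((1 + t) powr (1 - lam) - 1))) has_real_derivative
        exp (\<mu> / (1 - lam) * ((1 + t) powr (1 - lam) - 1)) * (\<mu> / (1 - lam) * ((1 - lam) * (1 + t) powr (- lam)))) (at t)"
      by simp
    then show ?thesis using False unfolding b by (simp add: powr_minus_divide mult.commute)
  qed
  then show ?thesis by (rule has_field_derivative_at_within)
qed

lemma beta_fun_pos: "t \<ge> 0 \<Longrightarrow> beta_fun \<mu> lam t > 0"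
  by (simp add: beta_fun_def)

lemma beta_fun_0: "beta_fun \<mu> lam 0 = 1"
  by (simp add: beta_fun_def)

theorem theorem4p1:
  fixes A \<gamma> \<rho>bar \<mu> lam M T Tstar :: real
    and \<rho>0 :: "real^3 \<Rightarrow> real" and u0 :: "real^3 \<Rightarrow> real^3"
    and \<rho> :: "real \<Rightarrow> real^3 \<Rightarrow> real" and u :: "real \<Rightarrow> real^3 \<Rightarrow> real^3"
  assumes "A > 0" and "\<gamma> > 1" and "\<rho>bar > 0"
    and "sound_speed A \<gamma> \<rho>bar = 1"
    and "\<mu> > 0" and "lam \<ge> 0"
    and "test_function \<rho>0" and "supp \<rho>0 \<subseteq> {x. norm x \<le> M}"
    and "test_function u0" and "supp u0 \<subseteq> {x. norm x \<le> M}"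
    and "\<forall>x. \<rho> 0 x > 0"
    and "T \<ge> 0"
    and "damped_euler_solution A \<gamma> \<rho>bar \<mu> lam \<rho>0 u0 T \<rho> u"
    and "L_fun \<rho>bar \<rho> 0 \<ge> 0"
    and "Tstar > 0"
    and "H_fun \<rho> u 0 *
           integral {0..Tstar}
             (\<lambda>\<tau>. 1 / (alpha_fun \<rho>bar M (L_fun \<rho>bar \<rho> 0) \<tau> * beta_fun \<mu> lam \<tau>)) > 1"
  shows "T < Tstar"
proof (rule ccontr)
  assume "\<not> T < Tstar"
  then have TT: "Tstar \<le> T" and T: "T > 0" using \<open>Tstar > 0\<close> by auto
  have "((\<lambda>s. A * s powr \<gamma>) has_real_derivative A * (\<gamma> * \<rho>bar powr (\<gamma> - 1))) (at \<rho>bar)"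
    using \<open>\<rho>bar > 0\<close> by (auto intro!: derivative_eq_intros)
  then have "deriv (pressure A \<gamma>) \<rho>bar = A * \<gamma> * \<rho>bar powr (\<gamma> - 1)"
    by (intro DERIV_imp_deriv) (simp add: pressure_def[abs_def] mult.assoc)
  then have c1: "A * \<gamma> * \<rho>bar powr (\<gamma> - 1) = 1"
    using \<open>sound_speed A \<gamma> \<rho>bar = 1\<close> by (simp add: sound_speed_def)
  then interpret gas: normalized_gas A \<gamma> \<rho>bar
    using assms by unfold_locales auto
  have init: "\<rho> 0 x = \<rho>bar" "u 0 x = 0" if "norm x > M" for x
  proof -
    have "x \<notin> supp \<rho>0" "x \<notin> supp u0"
      using that assms(8,10) by auto
    then have "\<rho>0 x = 0" "u0 x = 0"
      using closure_subset[of "{x. \<rho>0 x \<noteq> 0}"] closure_subset[of "{x. u0 x \<noteq> 0}"]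
      unfolding supp_def by auto
    then show "\<rho> 0 x = \<rho>bar" "u 0 x = 0"
      using assms(13) unfolding damped_euler_solution_def by auto
  qed
  \<comment> \<open>For \<open>M \<le> 0\<close> the initial velocity vanishes off the origin, so that \<open>H(0) = 0\<close>.\<close>
  have M: "M > 0"
  proof (rule ccontr)
    assume "\<not> M > 0"
    then have "u 0 x = 0" if "x \<noteq> 0" for x
      using init(2)[of x] that by (meson le_less_trans not_less zero_less_norm_iff)
    then have "x \<bullet> (\<rho> 0 x *\<^sub>R u 0 x) = 0" for x by (cases "x = 0") auto
    then have "H_fun \<rho> u 0 = 0" unfolding H_fun_def by (simp only: integral_zero)
    then show False using assms(16) by simp
  qed
  obtain rt rx vt vx where
    "damped_euler A \<gamma> \<rho>bar T (\<lambda>t. \<mu> / (1 + t) powr lam) \<rho> (\<lambda>i t x. u t x $ i) rt rx vt vx"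
    using damped_euler_of_solution[OF gas.normalized_gas_axioms \<open>\<mu> > 0\<close> T assms(13)] .
  then interpret E: damped_euler_front A \<gamma> \<rho>bar T "\<lambda>t. \<mu> / (1 + t) powr lam" \<rho> "\<lambda>i t x. u t x $ i" rt rx vt vx M
    unfolding damped_euler_front_def damped_euler_front_axioms_def using M init assms(11) by simp
  define \<alpha> where "\<alpha> = alpha_fun \<rho>bar M (L_fun \<rho>bar \<rho> 0)"
  have L: "L_fun \<rho>bar \<rho> 0 = E.excess_mass 0" by (simp add: L_fun_def E.excess_mass_def)
  have H: "H_fun \<rho> u t = E.H t" for t
    by (simp add: H_fun_def E.H_def E.radial_momentum_def inner_vec_def)
  have \<alpha>_pos: "\<alpha> t > 0" if "t \<ge> 0" for t
    unfolding \<alpha>_def alpha_fun_def using that M assms(3,14)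
    by (intro mult_pos_pos add_nonneg_pos) auto
  have \<alpha>_ge: "\<alpha> t \<ge> (M + t)^2 * (E.excess_mass 0 + 4 / 3 * pi * \<rho>bar * (M + t)^3)" if "t \<ge> 0" for t
  proof -
    \<comment> \<open>The volume of the ball has the constant \<open>4 \<pi> / 3\<close>, while \<open>\<alpha>\<close> is defined with the larger \<open>4 \<pi>\<^sup>2 / 3\<close>.\<close>
    have "pi * 1 \<le> pi * pi" using pi_gt3 by (intro mult_left_mono) auto
    then have "4 / 3 * pi * \<rho>bar * (M + t)^3 \<le> 4 * pi^2 * \<rho>bar / 3 * (t + M)^3"
      using that M assms(3) by (simp add: power2_eq_square add.commute)
    then show ?thesis
      unfolding \<alpha>_def alpha_fun_def L by (simp add: add.commute mult_left_mono)
  qed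
  have \<alpha>_cont: "continuous_on {0..T} \<alpha>"
    unfolding \<alpha>_def alpha_fun_def by (intro continuous_intros)
  define J where "J = integral {0..Tstar} (\<lambda>\<tau>. 1 / (\<alpha> \<tau> * beta_fun \<mu> lam \<tau>))"
  have HJ: "E.H 0 * J > 1" using assms(16) by (simp add: J_def \<alpha>_def H)
  have "J \<ge> 0"
    unfolding J_def by (cases "(\<lambda>\<tau>. 1 / (\<alpha> \<tau> * beta_fun \<mu> lam \<tau>)) integrable_on {0..Tstar}")
      (auto simp: not_integrable_integral less_imp_le \<alpha>_pos beta_fun_pos intro!: Henstock_Kurzweil_Integration.integral_nonneg)
  have "E.H 0 > 0"
  proof (rule ccontr)
    assume "\<not> E.H 0 > 0"
    then have "E.H 0 * J \<le> 0" using \<open>J \<ge> 0\<close> by (simp add: mult_nonpos_nonneg)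
    then show False using HJ by simp
  qed
  have "E.H 0 * J < 1"
    unfolding J_def
  proof (rule riccati_blowup[where ?T1.0 = T and b = "\<lambda>t. \<mu> / (1 + t) powr lam"])
    show "(E.H has_real_derivative (LINT x|lborel. \<rho> t x * E.speed2 t x
        + 3 * (pressure A \<gamma> (\<rho> t x) - pressure A \<gamma> \<rho>bar) - \<mu> / (1 + t) powr lam * E.radial_momentum t x)) (at t within {0..T})"
      if "t \<in> {0..T}" for t
      by (rule E.DERIV_H(1)[OF that])
    show "(E.H t)^2 / \<alpha> t - \<mu> / (1 + t) powr lam * E.H t \<le> (LINT x|lborel. \<rho> t x * E.speed2 t x
        + 3 * (pressure A \<gamma> (\<rho> t x) - pressure A \<gamma> \<rho>bar) - \<mu> / (1 + t) powr lam * E.radial_momentum t x)"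
      if "t \<in> {0..T}" for t
      by (rule E.H_riccati) (use that assms(14) L \<alpha>_pos \<alpha>_ge in auto)
    show "(beta_fun \<mu> lam has_real_derivative \<mu> / (1 + t) powr lam * beta_fun \<mu> lam t) (at t within {0..T})"
      if "t \<in> {0..T}" for t
      by (rule DERIV_beta_fun) (use that in simp)
  qed (use \<open>Tstar > 0\<close> TT \<alpha>_pos \<alpha>_cont \<open>E.H 0 > 0\<close> in \<open>auto simp: beta_fun_pos beta_fun_0\<close>)
  then show False using HJ by simp
qed

end
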